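(* Let $A=(a_{pq})$, $p,q=1,\dots,n$, be an $n\times n$ matrix over the quaternions $\mathbb{H}$, let $i,j\in\{1,\dots,n\}$, and suppose that the quasideterminant $|A|_{ij}$ is defined (i.e. the submatrix $A^{ij}$ is invertible). Then $$ \nu(A^{ij})\,|A|_{ij}=\sum_{B}(-1)^{K(B)-1}\,\nu(B^c)\,\pi_{ij}(B), $$ where the sum is taken over all square submatrices $B$ of $A$ containing the entry $a_{ij}$, and $K(B)$ denotes the order of $B$.
   Context: Quaternions: $\mathbb{H}$ is the algebra of real quaternions with conjugation $h\mapsto\bar h$; $\nu(h)=h\bar h\in\mathbb{R}_{\ge 0}$. Quasideterminants: for an $n\times n$ matrix $A$ over a ring, $A^{ij}$ is the submatrix obtained by deleting the $i$-th row and $j$-th column. If $A^{ij}$ is invertible, the quasideterminant $|A|_{ij}$ is defined by $|A|_{ij}=a_{ij}-r_i^j(A^{ij})^{-1}c_j^i$, where $r_i^j$ is the $i$-th row of $A$ with $a_{ij}$ deleted and $c_j^i$ is the $j$-th column of $A$ with $a_{ij}$ deleted; for $n=1$, $|A|_{11}=a_{11}$. Norm of a quaternionic matrix: a matrix is generic if all its square submatrices are invertible. For generic $A$ over $\mathbb{H}$ the norm $\nu(A)\in\mathbb{R}_{\ge0}$ is defined by induction on the order: $\nu((a))=\nu(a)$ for a $1\times1$ matrix $(a)$, and $\nu(A)=\nu(|A|_{11})\,\nu(A^{11})$. This is a polynomial in the entries and their conjugates and extends by continuity to a multiplicative functional $\nu$ on all of $M(n,\mathbb{H})$, with $\nu(A)=0$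 if and only if $A$ is non-invertible, and invariant under adding a left multiple of a row to another row or a right multiple of a column to another column. The norm of the empty ($0\times 0$) matrix is $1$. Complementary submatrix: for a square submatrix $B$ of $A$, $B^c$ is the submatrix obtained from $A$ by omitting all rows and columns that contain elements of $B$; if $B$ is $k\times k$ then $B^c$ is $(n-k)\times(n-k)$. A submatrix $B$ is given by an arbitrary set of rows and an arbitrary set of columns of $A$ of equal size, and keeps the row and column indices of $A$. Double permanent: for sequences $I=(i_1,\dots,i_k)$ of distinct row indices and $J=(j_1,\dots,j_k)$ of distinct column indices put $m_{I,J}(A)=a_{i_1j_1}$ if $k=1$, and for $k\ge2$ $$m_{I,J}(A)=a_{i_1j_2}\,\bar a_{i_2j_2}\,a_{i_2j_3}\,\bar a_{i_3j_3}\,a_{i_3j_4}\cdots\bar a_{i_kj_k}\,a_{i_kj_1}.$$ For a $k\times k$ submatrix $B$ of $A$ containing $a_{ij}$, the $(i,j)$-th double permanent is $\pi_{ij}(B)=\sum m_{I,J}(A)$, summed over all orderings $I=(i_1,\dots,i_k)$ of the row indices of $B$ with $i_1=i$ and all orderings $J=(j_1,\dots,j_k)$ of the column indices of $B$ with $j_1=j$. *)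

theory Defs
  imports
    "HOL-Analysis.Inner_Product"
    "HOL-Combinatorics.Multiset_Permutations"
    "Jordan_Normal_Form.Determinant"
    "Jordan_Normal_Form.DL_Submatrix"
begin

section \<open>Real quaternions\<close>

datatype quat = Quat (qre: real) (qim1: real) (qim2: real) (qim3: real)

lemma quat_eq_iff:
  "x = y \<longleftrightarrow> qre x = qre y \<and> qim1 x = qim1 y \<and> qim2 x = qim2 y \<and> qim3 x = qim3 y"
  by (cases x; cases y) simp

instantiation quat :: ring_1
begin

definition "0 = Quat 0 0 0 0"
definition "1 = Quat 1 0 0 0"
definition "x + y = Quat (qre x + qre y) (qim1 x + qim1 y) (qim2 x + qim2 y) (qim3 x + qim3 y)"
definition "- x = Quat (- qre x) (- qim1 x) (- qim2 x) (- qim3 x)"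
definition "x - y = Quat (qre x - qre y) (qim1 x - qim1 y) (qim2 x - qim2 y) (qim3 x - qim3 y)"
definition "x * y = Quat
  (qre x * qre y - qim1 x * qim1 y - qim2 x * qim2 y - qim3 x * qim3 y)
  (qre x * qim1 y + qim1 x * qre y + qim2 x * qim3 y - qim3 x * qim2 y)
  (qre x * qim2 y - qim1 x * qim3 y + qim2 x * qre y + qim3 x * qim1 y)
  (qre x * qim3 y + qim1 x * qim2 y - qim2 x * qim1 y + qim3 x * qre y)"

instance
  by standard
    (simp_all add: quat_eq_iff zero_quat_def one_quat_def plus_quat_def uminus_quat_def
      minus_quat_def times_quat_def algebra_simps)

end

lemma quat_zero_simps [simp]: "qre 0 = 0" "qim1 0 = 0" "qim2 0 = 0" "qim3 0 = 0"
  by (simp_all add: zero_quat_def)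

lemma quat_one_simps [simp]: "qre 1 = 1" "qim1 1 = 0" "qim2 1 = 0" "qim3 1 = 0"
  by (simp_all add: one_quat_def)

lemma quat_plus_simps [simp]:
  "qre (x + y) = qre x + qre y" "qim1 (x + y) = qim1 x + qim1 y"
  "qim2 (x + y) = qim2 x + qim2 y" "qim3 (x + y) = qim3 x + qim3 y"
  by (simp_all add: plus_quat_def)

lemma quat_uminus_simps [simp]:
  "qre (- x) = - qre x" "qim1 (- x) = - qim1 x" "qim2 (- x) = - qim2 x" "qim3 (- x) = - qim3 x"
  by (simp_all add: uminus_quat_def)

lemma quat_minus_simps [simp]:
  "qre (x - y) = qre x - qre y" "qim1 (x - y) = qim1 x - qim1 y"
  "qim2 (x - y) = qim2 x - qim2 y" "qim3 (x - y) = qim3 x - qim3 y"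
  by (simp_all add: minus_quat_def)

lemma quat_times_simps [simp]:
  "qre (x * y) = qre x * qre y - qim1 x * qim1 y - qim2 x * qim2 y - qim3 x * qim3 y"
  "qim1 (x * y) = qre x * qim1 y + qim1 x * qre y + qim2 x * qim3 y - qim3 x * qim2 y"
  "qim2 (x * y) = qre x * qim2 y - qim1 x * qim3 y + qim2 x * qre y + qim3 x * qim1 y"
  "qim3 (x * y) = qre x * qim3 y + qim1 x * qim2 y - qim2 x * qim1 y + qim3 x * qre y"
  by (simp_all add: times_quat_def)

instantiation quat :: real_algebra_1
begin

definition "r *\<^sub>R x = Quat (r * qre x) (r * qim1 x) (r * qim2 x) (r * qim3 x)"

instance
  by standard (simp_all add: quat_eq_iff scaleR_quat_def algebra_simps)

end

lemma quat_scaleR_simps [simp]: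
  "qre (r *\<^sub>R x) = r * qre x" "qim1 (r *\<^sub>R x) = r * qim1 x"
  "qim2 (r *\<^sub>R x) = r * qim2 x" "qim3 (r *\<^sub>R x) = r * qim3 x"
  by (simp_all add: scaleR_quat_def)

lemma quat_of_real_simps [simp]:
  "qre (of_real r) = r" "qim1 (of_real r) = 0" "qim2 (of_real r) = 0" "qim3 (of_real r) = 0"
  by (simp_all add: of_real_def)

instantiation quat :: real_inner
begin

definition "inner x y = qre x * qre y + qim1 x * qim1 y + qim2 x * qim2 y + qim3 x * qim3 y"
definition "norm x = sqrt (inner x x)" for x :: quat
definition "sgn x = x /\<^sub>R norm x" for x :: quat
definition "dist x y = norm (x - y)" for x y :: quat
definition [code del]:
  "(uniformity :: (quat \<times> quat) filter) = (INF e\<in>{0<..}. principal {(x, y). dist x y < e})"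
definition [code del]:
  "open (U :: quat set) \<longleftrightarrow> (\<forall>x\<in>U. \<forall>\<^sub>F (x', y) in uniformity. x' = x \<longrightarrow> y \<in> U)"

instance
proof
  fix x y z :: quat and r :: real
  show "dist x y = norm (x - y)" by (fact dist_quat_def)
  show "sgn x = x /\<^sub>R norm x" by (fact sgn_quat_def)
  show "uniformity = (INF e\<in>{0<..}. principal {(x :: quat, y). dist x y < e})"
    by (fact uniformity_quat_def)
  show "open U \<longleftrightarrow> (\<forall>x\<in>U. \<forall>\<^sub>F (x', y) in uniformity. x' = x \<longrightarrow> y \<in> U)" for U :: "quat set"
    by (fact open_quat_def)
  show "norm x = sqrt (inner x x)" by (fact norm_quat_def)
  show "inner x y = inner y x" by (simp add: inner_quat_def mult.commute)
  show "inner (x + y) z = inner x z + inner y z" by (simp add: inner_quat_def algebra_simps)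
  show "inner (r *\<^sub>R x) y = r * inner x y" by (simp add: inner_quat_def algebra_simps)
  show "0 \<le> inner x x" by (simp add: inner_quat_def)
  have "a * a + b * b + c * c + d * d = 0 \<longleftrightarrow> a = 0 \<and> b = 0 \<and> c = 0 \<and> d = 0" for a b c d :: real
    by (smt (verit) mult_eq_0_iff zero_le_square)
  then show "inner x x = 0 \<longleftrightarrow> x = 0" by (simp add: inner_quat_def quat_eq_iff)
qed

end

definition qcnj :: "quat \<Rightarrow> quat" where
  "qcnj x = Quat (qre x) (- qim1 x) (- qim2 x) (- qim3 x)"

lemma qcnj_simps [simp]:
  "qre (qcnj x) = qre x" "qim1 (qcnj x) = - qim1 x"
  "qim2 (qcnj x) = - qim2 x" "qim3 (qcnj x) = - qim3 x"
  by (simp_all add: qcnj_def)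

text \<open>The product of a quaternion and its conjugate is real (see \<open>of_real_nu\<close>), so its real part is
  the product itself, taken in the reals.\<close>

definition nu :: "quat \<Rightarrow> real" where
  "nu h = qre (h * qcnj h)"

lemma of_real_nu: "of_real (nu h) = h * qcnj h"
  by (simp add: nu_def quat_eq_iff)

lemma nu_eq_inner: "nu h = inner h h"
  by (simp add: nu_def inner_quat_def)

instantiation quat :: real_normed_div_algebra
begin

definition "inverse x = qcnj x /\<^sub>R nu x"
definition "x div y = x * inverse y" for x y :: quat

instance
proof
  fix x y :: quat
  show "norm (x * y) = norm x * norm y"
    unfolding norm_quat_def inner_quat_def real_sqrt_mult[symmetric]
    by (rule arg_cong[where f = sqrt]) (simp add: algebra_simps)
  show "x div y = x * inverse y" by (fact divide_quat_def)
  show "inverse (0 :: quat) = 0" by (simp add: inverse_quat_def quat_eq_iff)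
  have comm: "qcnj z * z = z * qcnj z" for z by (simp add: quat_eq_iff)
  assume "x \<noteq> 0"
  then have "nu x \<noteq> 0" by (simp add: nu_eq_inner)
  then show "inverse x * x = 1" "x * inverse x = 1"
    by (simp_all add: inverse_quat_def comm of_real_nu[symmetric] of_real_def)
qed

end


section \<open>Quasideterminants\<close>

text \<open>Matrices are those of \<open>Jordan_Normal_Form\<close>, with rows and columns indexed from 0.\<close>

definition mat_inv :: "'a :: ring_1 mat \<Rightarrow> 'a mat" where
  "mat_inv A = (THE B. inverts_mat A B \<and> inverts_mat B A)"

definition row_delete :: "'a mat \<Rightarrow> nat \<Rightarrow> nat \<Rightarrow> 'a vec" where
  "row_delete A i j = vec (dim_col A - 1) (\<lambda>l. A $$ (i, if l < j then l else Suc l))"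

definition col_delete :: "'a mat \<Rightarrow> nat \<Rightarrow> nat \<Rightarrow> 'a vec" where
  "col_delete A i j = vec (dim_row A - 1) (\<lambda>k. A $$ (if k < i then k else Suc k, j))"

text \<open>If \<open>A\<close> is \<open>1 \<times> 1\<close>, the deleted matrix and vectors are empty and the value is the entry of \<open>A\<close>.\<close>

definition quasidet :: "'a :: ring_1 mat \<Rightarrow> nat \<Rightarrow> nat \<Rightarrow> 'a" where
  "quasidet A i j =
     A $$ (i, j) - row_delete A i j \<bullet> (mat_inv (mat_delete A i j) *\<^sub>v col_delete A i j)"


section \<open>Norm of a quaternionic matrix\<close>

definition generic_mat :: "'a :: ring_1 mat \<Rightarrow> bool" where
  "generic_mat A \<longleftrightarrow> square_mat A \<and>
     (\<forall>I J. I \<subseteq> {..<dim_row A} \<longrightarrow> J \<subseteq> {..<dim_col A} \<longrightarrow> card I = card J \<longrightarrow>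
        invertible_mat (submatrix A I J))"

text \<open>The first argument is the order of the matrix.\<close>

fun generic_nu :: "nat \<Rightarrow> quat mat \<Rightarrow> real" where
  "generic_nu 0 A = 1"
| "generic_nu (Suc 0) A = nu (A $$ (0, 0))"
| "generic_nu (Suc (Suc n)) A = nu (quasidet A 0 0) * generic_nu (Suc n) (mat_delete A 0 0)"

text \<open>Extension by continuity: the value at a square matrix \<open>A\<close> is the common limit of the norms
  of all sequences of generic matrices of the same order that converge to \<open>A\<close> entrywise.\<close>

definition mat_nu :: "quat mat \<Rightarrow> real" where
  "mat_nu A = (THE L. \<forall>X.
     (\<forall>m. X m \<in> carrier_mat (dim_row A) (dim_row A) \<and> generic_mat (X m)) \<longrightarrow>
     (\<forall>i<dim_row A. \<forall>j<dim_row A. (\<lambda>m. X m $$ (i, j)) \<longlonglongrightarrow> A $$ (i, j)) \<longrightarrow>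
     (\<lambda>m. generic_nu (dim_row A) (X m)) \<longlonglongrightarrow> L)"


section \<open>Double permanents\<close>

text \<open>A square submatrix \<open>B\<close> of \<open>A\<close> is represented by its set \<open>I\<close> of rows and its set \<open>J\<close> of columns,
  so that it keeps the indices it has in \<open>A\<close>.\<close>

definition square_submatrices :: "nat \<Rightarrow> (nat set \<times> nat set) set" where
  "square_submatrices n = {(I, J). I \<subseteq> {..<n} \<and> J \<subseteq> {..<n} \<and> card I = card J}"

definition compl_submatrix :: "'a mat \<Rightarrow> nat set \<Rightarrow> nat set \<Rightarrow> 'a mat" where
  "compl_submatrix A I J = submatrix A ({..<dim_row A} - I) ({..<dim_col A} - J)"

text \<open>\<open>ps\<close> and \<open>qs\<close> are nonempty lists of equal length; for length 1 the product over \<open>t\<close> is empty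
  and only the last factor, a single entry of \<open>A\<close>, remains. The factors do not commute;
  \<open>prod_list\<close> multiplies them from left to right.\<close>

definition dperm_monomial :: "quat mat \<Rightarrow> nat list \<Rightarrow> nat list \<Rightarrow> quat" where
  "dperm_monomial A ps qs =
     (\<Prod>t\<leftarrow>[1..<length ps]. A $$ (ps ! (t - 1), qs ! t) * qcnj (A $$ (ps ! t, qs ! t)))
       * A $$ (last ps, hd qs)"

definition double_permanent :: "quat mat \<Rightarrow> nat set \<Rightarrow> nat set \<Rightarrow> nat \<Rightarrow> nat \<Rightarrow> quat" where
  "double_permanent A I J i j =
     (\<Sum>ps \<in> {ps \<in> permutations_of_set I. hd ps = i}.
        \<Sum>qs \<in> {qs \<in> permutations_of_set J. hd qs = j}. dperm_monomial A ps qs)"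

end

theory Submission
  imports Defs "Jordan_Normal_Form.Char_Poly"
begin

text \<open>
  The norm is the absolute value of the determinant of the complex \<open>2n \<times> 2n\<close> representation. That
  function is multiplicative and continuous and satisfies the Schur complement recursion, which
  defines the norm on generic matrices.

  Splitting off the first two factors of the monomials, the right-hand side \<open>P\<^sub>i\<^sub>j(A)\<close> satisfies
  \<open>P\<^sub>i\<^sub>j(A) = \<nu>(A\<^sup>i\<^sup>j) a\<^sub>i\<^sub>j - \<Sum> a\<^sub>i\<^sub>l cnj(a\<^sub>k\<^sub>l) P\<^sub>k\<^sub>j(A\<^sup>i\<^sup>l)\<close>, the sum over \<open>k \<noteq> i\<close> and \<open>l \<noteq> j\<close>. For generic \<open>A\<close>
  the left-hand side satisfies the same recursion. Indeed the entries of the inverse of \<open>A\<^sup>i\<^sup>j\<close> are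
  inverses of quasideterminants, and what remains to be shown is that a sesquilinear form attached
  to a matrix \<open>C\<close> with one row more than columns is Hermitian. Its coefficients are
  \<open>\<nu>(C\<^sup>k) w\<^sub>m\<close>, where \<open>C\<^sup>k\<close> is \<open>C\<close> without row \<open>k\<close> and \<open>w\<close> is the left kernel vector of \<open>C\<close>
  normalised to be 1 at \<open>k\<close>; the symmetry holds because \<open>\<nu>(C\<^sup>m) = \<nu>(w\<^sub>m) \<nu>(C\<^sup>k)\<close>.

  For arbitrary \<open>A\<close> the generic case extends by continuity to two identities that involve only
  \<open>\<nu>\<close> and \<open>P\<close>: one says that the conjugates of the \<open>P\<close> form an adjugate matrix, the other is
  the recursion written with this adjugate. They give the theorem whenever \<open>A\<^sup>i\<^sup>j\<close> is invertible.
\<close>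

section \<open>The complex representation\<close>

text \<open>The quaternion \<open>z + w j\<close> with complex \<open>z, w\<close> becomes the matrix with rows
  \<open>(z, w)\<close> and \<open>(- cnj w, cnj z)\<close>.\<close>

definition centry :: "quat \<Rightarrow> nat \<Rightarrow> nat \<Rightarrow> complex" where
  "centry q s t =
     (if s = 0 then if t = 0 then Complex (qre q) (qim1 q) else Complex (qim2 q) (qim3 q)
      else if t = 0 then Complex (- qim2 q) (qim3 q) else Complex (qre q) (- qim1 q))"

lemma centry_add: "centry (x + y) s t = centry x s t + centry y s t"
  by (simp add: centry_def complex_eq_iff)

lemma centry_zero [simp]: "centry 0 s t = 0"
  by (simp add: centry_def complex_eq_iff)

lemma centry_sum: "centry (sum f A) s t = (\<Sum>x\<in>A. centry (f x) s t)"
  by (induction A rule: infinite_finite_induct) (simp_all add: centry_add)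

lemma centry_mult:
  "centry (x * y) s t = centry x s 0 * centry y 0 t + centry x s 1 * centry y 1 t"
  by (simp add: centry_def complex_eq_iff algebra_simps)

lemma centry_one: "s < 2 \<Longrightarrow> t < 2 \<Longrightarrow> centry 1 s t = of_bool (s = t)"
  by (auto simp: centry_def complex_eq_iff less_2_cases_iff)

lemma centry_scaleR: "centry (r *\<^sub>R x) s t = of_real r * centry x s t"
  by (simp add: centry_def complex_eq_iff)

text \<open>Each coordinate is the inner product with a basis quaternion, and \<open>inner\<close>
  is continuous.\<close>

lemma tendsto_qparts:
  assumes "(f \<longlongrightarrow> l) F"
  shows "((\<lambda>x. qre (f x)) \<longlongrightarrow> qre l) F" "((\<lambda>x. qim1 (f x)) \<longlongrightarrow> qim1 l) F"
    "((\<lambda>x. qim2 (f x)) \<longlongrightarrow> qim2 l) F" "((\<lambda>x. qim3 (f x)) \<longlongrightarrow> qim3 l) F"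
proof -
  have *: "((\<lambda>x. inner (f x) u) \<longlongrightarrow> inner l u) F" for u
    by (intro tendsto_inner assms tendsto_const)
  show "((\<lambda>x. qre (f x)) \<longlongrightarrow> qre l) F" using *[of "Quat 1 0 0 0"] by (simp add: inner_quat_def)
  show "((\<lambda>x. qim1 (f x)) \<longlongrightarrow> qim1 l) F" using *[of "Quat 0 1 0 0"] by (simp add: inner_quat_def)
  show "((\<lambda>x. qim2 (f x)) \<longlongrightarrow> qim2 l) F" using *[of "Quat 0 0 1 0"] by (simp add: inner_quat_def)
  show "((\<lambda>x. qim3 (f x)) \<longlongrightarrow> qim3 l) F" using *[of "Quat 0 0 0 1"] by (simp add: inner_quat_def)
qed

lemma tendsto_centry:
  assumes "(f \<longlongrightarrow> l) F"
  shows "((\<lambda>x. centry (f x) s t) \<longlongrightarrow> centry l s t) F"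
  unfolding centry_def by (auto intro!: tendsto_Complex tendsto_qparts[OF assms] tendsto_minus)

text \<open>The \<open>(k, l)\<close> entry becomes the \<open>2 \<times> 2\<close> block at rows \<open>2k, 2k + 1\<close> and columns
  \<open>2l, 2l + 1\<close>, so that block matrices go to block matrices.\<close>

definition cmat :: "quat mat \<Rightarrow> complex mat" where
  "cmat A = mat (2 * dim_row A) (2 * dim_col A)
     (\<lambda>(r, c). centry (A $$ (r div 2, c div 2)) (r mod 2) (c mod 2))"

lemma dim_cmat [simp]: "dim_row (cmat A) = 2 * dim_row A" "dim_col (cmat A) = 2 * dim_col A"
  by (simp_all add: cmat_def)

lemma cmat_carrier [simp]: "A \<in> carrier_mat m n \<Longrightarrow> cmat A \<in> carrier_mat (2 * m) (2 * n)"
  by (auto intro: carrier_matI)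

lemma index_cmat:
  "r < 2 * dim_row A \<Longrightarrow> c < 2 * dim_col A \<Longrightarrow>
    cmat A $$ (r, c) = centry (A $$ (r div 2, c div 2)) (r mod 2) (c mod 2)"
  by (simp add: cmat_def)

lemma sum_lessThan_double: "(\<Sum>k\<in>{0..<2 * n}. f k) = (\<Sum>k\<in>{0..<n}. f (2 * k) + f (2 * k + 1))"
  for f :: "nat \<Rightarrow> 'a :: comm_monoid_add"
  by (induction n) (simp_all add: add.assoc)

lemma index_cmat':
  assumes "k < dim_row A" "l < dim_col A" "s < 2" "t < 2"
  shows "cmat A $$ (2 * k + s, 2 * l + t) = centry (A $$ (k, l)) s t"
proof -
  have "(2 * k + s) div 2 = k" "(2 * k + s) mod 2 = s" "(2 * l + t) div 2 = l" "(2 * l + t) mod 2 = t"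
    using assms by simp_all
  moreover have "2 * k + s < 2 * dim_row A" "2 * l + t < 2 * dim_col A" using assms by linarith+
  ultimately show ?thesis by (simp only: index_cmat)
qed

lemma cmat_eqI:
  assumes A: "A \<in> carrier_mat m n" and B: "B \<in> carrier_mat (2 * m) (2 * n)"
    and eq: "\<And>k l s t. k < m \<Longrightarrow> l < n \<Longrightarrow> s < 2 \<Longrightarrow> t < 2 \<Longrightarrow>
      centry (A $$ (k, l)) s t = B $$ (2 * k + s, 2 * l + t)"
  shows "cmat A = B"
proof (rule eq_matI)
  fix r c assume rc: "r < dim_row B" "c < dim_col B"
  have "r div 2 < m" "c div 2 < n" "r mod 2 < 2" "c mod 2 < 2" using rc B by auto
  then show "cmat A $$ (r, c) = B $$ (r, c)"
    using rc A B eq[of "r div 2" "c div 2" "r mod 2" "c mod 2"] by (simp add: index_cmat)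
qed (use A B in auto)

lemma cmat_mult:
  assumes A: "A \<in> carrier_mat l m" and B: "B \<in> carrier_mat m n"
  shows "cmat (A * B) = cmat A * cmat B"
proof (rule cmat_eqI[of _ l n])
  fix r c s t :: nat assume rc: "r < l" "c < n" "s < 2" "t < 2"
  then have l: "2 * r + s < 2 * l" "2 * c + t < 2 * n" by linarith+
  have "(A * B) $$ (r, c) = (\<Sum>k\<in>{0..<m}. A $$ (r, k) * B $$ (k, c))"
    using A B rc by (simp add: scalar_prod_def)
  also have "centry \<dots> s t =
      (\<Sum>k\<in>{0..<m}. centry (A $$ (r, k)) s 0 * centry (B $$ (k, c)) 0 t
        + centry (A $$ (r, k)) s 1 * centry (B $$ (k, c)) 1 t)"
    unfolding centry_sum centry_mult ..
  also have "\<dots> = (\<Sum>k\<in>{0..<2 * m}. cmat A $$ (2 * r + s, k) * cmat B $$ (k, 2 * c + t))"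
    unfolding sum_lessThan_double
  proof (intro sum.cong refl)
    fix k assume "k \<in> {0..<m}"
    then have k: "k < m" by simp
    have "cmat A $$ (2 * r + s, 2 * k) = centry (A $$ (r, k)) s 0"
      "cmat B $$ (2 * k, 2 * c + t) = centry (B $$ (k, c)) 0 t"
      "cmat A $$ (2 * r + s, 2 * k + 1) = centry (A $$ (r, k)) s 1"
      "cmat B $$ (2 * k + 1, 2 * c + t) = centry (B $$ (k, c)) 1 t"
      using index_cmat'[of r A k s 0] index_cmat'[of r A k s 1] index_cmat'[of k B c 0 t]
        index_cmat'[of k B c 1 t] A B rc k by auto
    then show "centry (A $$ (r, k)) s 0 * centry (B $$ (k, c)) 0 t
        + centry (A $$ (r, k)) s 1 * centry (B $$ (k, c)) 1 t =
      cmat A $$ (2 * r + s, 2 * k) * cmat B $$ (2 * k, 2 * c + t) +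
      cmat A $$ (2 * r + s, 2 * k + 1) * cmat B $$ (2 * k + 1, 2 * c + t)" by simp
  qed
  also have "\<dots> = (cmat A * cmat B) $$ (2 * r + s, 2 * c + t)"
    using A B l by (simp add: scalar_prod_def)
  finally show "centry ((A * B) $$ (r, c)) s t = (cmat A * cmat B) $$ (2 * r + s, 2 * c + t)" .
qed (use assms in auto)

lemma double_add_eq_iff: "s < 2 \<Longrightarrow> t < 2 \<Longrightarrow> 2 * k + s = 2 * l + t \<longleftrightarrow> k = l \<and> s = t" for k l s t :: nat
  by presburger

lemma cmat_one: "cmat (1\<^sub>m n) = 1\<^sub>m (2 * n)"
proof (rule cmat_eqI[of _ n n])
  fix k l s t :: nat assume kl: "k < n" "l < n" "s < 2" "t < 2"
  then have "2 * k + s < 2 * n" "2 * l + t < 2 * n" by linarith+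
  then show "centry (1\<^sub>m n $$ (k, l)) s t = 1\<^sub>m (2 * n) $$ (2 * k + s, 2 * l + t)"
    using kl by (simp add: centry_one double_add_eq_iff)
qed auto

section \<open>The Study determinant and its values on block triangular matrices\<close>

lemma det_dim_two:
  fixes A :: "'a :: comm_ring_1 mat"
  assumes "A \<in> carrier_mat 2 2"
  shows "det A = A $$ (0, 0) * A $$ (1, 1) - A $$ (0, 1) * A $$ (1, 0)"
proof -
  have "det (mat_delete A 0 0) = A $$ (1, 1)" "det (mat_delete A 1 0) = A $$ (0, 1)"
    using assms by (subst det_single; simp add: mat_delete_def)+
  then show ?thesis
    using laplace_expansion_column[OF assms, of 0] by (simp add: numeral_2_eq_2 cofactor_def mult.commute)
qed

text \<open>The Study determinant. At order 1 it equals \<open>nu\<close>, and the modulus makes it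
  nonnegative and blind to the signs of permutations.\<close>

definition study_norm :: "quat mat \<Rightarrow> real" where
  "study_norm A = cmod (det (cmat A))"

lemma study_norm_one [simp]: "study_norm (1\<^sub>m n) = 1"
  by (simp add: study_norm_def cmat_one)

lemma study_norm_mult:
  assumes "A \<in> carrier_mat n n" "B \<in> carrier_mat n n"
  shows "study_norm (A * B) = study_norm A * study_norm B"
  using assms by (simp add: study_norm_def cmat_mult[of _ n n _ n] det_mult[of _ "2 * n"] norm_mult)

text \<open>The 2 x 2 block of \<open>q\<close> has determinant |z|^2 + |w|^2, which is
  \<open>nu q\<close>; the rest is the determinant of a block triangular matrix.\<close>

lemma study_norm_upper_block:
  assumes B: "B \<in> carrier_mat 1 n" and C: "C \<in> carrier_mat n n"
  shows "study_norm (four_block_mat (mat 1 1 (\<lambda>_. q)) B (0\<^sub>m n 1) C) = nu q * study_norm C"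
proof -
  let ?Q = "mat 1 1 (\<lambda>_. q)"
  have "cmat (four_block_mat ?Q B (0\<^sub>m n 1) C) = four_block_mat (cmat ?Q) (cmat B) (0\<^sub>m (2 * n) 2) (cmat C)"
  proof (rule cmat_eqI[of _ "1 + n" "1 + n"])
    fix k l s t :: nat
    assume kl: "k < 1 + n" "l < 1 + n" "s < 2" "t < 2"
    consider "k = 0" "l = 0" | l' where "k = 0" "l = Suc l'" | k' where "k = Suc k'" "l = 0"
      | k' l' where "k = Suc k'" "l = Suc l'"
      by (metis not0_implies_Suc)
    then show "centry ((four_block_mat ?Q B (0\<^sub>m n 1) C) $$ (k, l)) s t = four_block_mat (cmat ?Q) (cmat B) (0\<^sub>m (2 * n) 2) (cmat C) $$ (2 * k + s, 2 * l + t)"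
    proof cases
      case 1 then show ?thesis using kl B C index_cmat'[of 0 ?Q 0 s t] by simp
    next
      case 2 then show ?thesis using kl B C index_cmat'[of 0 B l' s t] by simp
    next
      case 3 then show ?thesis using kl B C by simp
    next
      case 4 then show ?thesis using kl B C index_cmat'[of k' C l' s t] by simp
    qed
  qed (use B C in auto)
  moreover have "det (cmat ?Q) = of_real (nu q)"
    by (subst det_dim_two) (auto intro: carrier_matI simp: index_cmat centry_def complex_eq_iff nu_def)
  moreover have "det (four_block_mat (cmat ?Q) (cmat B) (0\<^sub>m (2 * n) 2) (cmat C)) =
      det (cmat ?Q) * det (cmat C)"
    by (rule det_four_block_mat_lower_left_zero[of _ 2 _ "2 * n"])
       (use cmat_carrier[OF B] cmat_carrier[OF C] in \<open>auto intro: carrier_matI\<close>)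
  moreover have "0 \<le> nu q" by (simp add: nu_eq_inner)
  ultimately show ?thesis by (simp add: study_norm_def norm_mult)
qed

lemma study_norm_lower_unipotent:
  assumes B: "B \<in> carrier_mat n 1"
  shows "study_norm (four_block_mat (1\<^sub>m 1) (0\<^sub>m 1 n) B (1\<^sub>m n)) = 1"
proof -
  have "cmat (four_block_mat (1\<^sub>m 1) (0\<^sub>m 1 n) B (1\<^sub>m n)) = four_block_mat (1\<^sub>m 2) (0\<^sub>m 2 (2 * n)) (cmat B) (1\<^sub>m (2 * n))"
  proof (rule cmat_eqI[of _ "1 + n" "1 + n"])
    fix k l s t :: nat
    assume kl: "k < 1 + n" "l < 1 + n" "s < 2" "t < 2"
    consider "k = 0" "l = 0" | l' where "k = 0" "l = Suc l'" | k' where "k = Suc k'" "l = 0"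
      | k' l' where "k = Suc k'" "l = Suc l'"
      by (metis not0_implies_Suc)
    then show "centry (four_block_mat (1\<^sub>m 1) (0\<^sub>m 1 n) B (1\<^sub>m n) $$ (k, l)) s t = four_block_mat (1\<^sub>m 2) (0\<^sub>m 2 (2 * n)) (cmat B) (1\<^sub>m (2 * n)) $$ (2 * k + s, 2 * l + t)"
    proof cases
      case 1 then show ?thesis using kl B by (simp add: centry_one)
    next
      case 2 then show ?thesis using kl B by simp
    next
      case 3 then show ?thesis using kl B index_cmat'[of k' B 0 s t] by simp
    next
      case 4 then show ?thesis using kl B by (simp add: centry_one double_add_eq_iff)
    qed
  qed (use B in auto)
  moreover have "det (four_block_mat (1\<^sub>m 2) (0\<^sub>m 2 (2 * n)) (cmat B) (1\<^sub>m (2 * n))) = (1 :: complex)"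
    by (subst det_four_block_mat_upper_right_zero[of _ 2 _ "2 * n"])
       (use cmat_carrier[OF B] in \<open>auto intro: carrier_matI\<close>)
  ultimately show ?thesis by (simp add: study_norm_def)
qed

section \<open>Inverses of quaternionic matrices\<close>

text \<open>Averages the two places in which \<open>centry\<close> stores each real coordinate,
  hence a left inverse of \<open>centry\<close>.\<close>

definition centry_retract :: "(nat \<Rightarrow> nat \<Rightarrow> complex) \<Rightarrow> quat" where
  "centry_retract m = Quat ((Re (m 0 0) + Re (m 1 1)) / 2) ((Im (m 0 0) - Im (m 1 1)) / 2)
     ((Re (m 0 1) - Re (m 1 0)) / 2) ((Im (m 0 1) + Im (m 1 0)) / 2)"

lemma centry_retract_sum:
  "centry_retract (\<lambda>s t. \<Sum>k\<in>K. m k s t) = (\<Sum>k\<in>K. centry_retract (m k))"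
  by (induction K rule: infinite_finite_induct)
     (simp_all add: centry_retract_def quat_eq_iff add_divide_distrib diff_divide_distrib)

lemma centry_retract_mult_left:
  "centry_retract (\<lambda>s t. centry q s 0 * m 0 t + centry q s 1 * m 1 t) = q * centry_retract m"
  by (simp add: centry_retract_def centry_def quat_eq_iff field_simps)

lemma centry_retract_mult_right:
  "centry_retract (\<lambda>s t. m s 0 * centry q 0 t + m s 1 * centry q 1 t) = centry_retract m * q"
  by (simp add: centry_retract_def centry_def quat_eq_iff field_simps)

lemma centry_retract_cong:
  "(\<And>s t. s < 2 \<Longrightarrow> t < 2 \<Longrightarrow> m s t = m' s t) \<Longrightarrow> centry_retract m = centry_retract m'"
  by (simp add: centry_retract_def)

definition cmat_retract :: "nat \<Rightarrow> nat \<Rightarrow> complex mat \<Rightarrow> quat mat" where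
  "cmat_retract m n W = mat m n (\<lambda>(k, l). centry_retract (\<lambda>s t. W $$ (2 * k + s, 2 * l + t)))"

lemma cmat_retract_carrier [simp]: "cmat_retract m n W \<in> carrier_mat m n"
  by (simp add: cmat_retract_def)

text \<open>Left linearity of the retraction in each block. It turns a complex right inverse of
  \<open>cmat A\<close> into a quaternionic right inverse of \<open>A\<close>.\<close>

lemma cmat_retract_mult_left:
  assumes A: "A \<in> carrier_mat l m" and W: "W \<in> carrier_mat (2 * m) (2 * n)"
  shows "cmat_retract l n (cmat A * W) = A * cmat_retract m n W"
proof (rule eq_matI)
  fix r c assume "r < dim_row (A * cmat_retract m n W)" "c < dim_col (A * cmat_retract m n W)"
  then have rc: "r < l" "c < n" using A by (auto simp: cmat_retract_def)
  have "centry_retract (\<lambda>s t. (cmat A * W) $$ (2 * r + s, 2 * c + t)) =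
    centry_retract (\<lambda>s t. \<Sum>k\<in>{0..<m}. centry (A $$ (r, k)) s 0 * W $$ (2 * k + 0, 2 * c + t)
       + centry (A $$ (r, k)) s 1 * W $$ (2 * k + 1, 2 * c + t))"
  proof (rule centry_retract_cong)
    fix s t :: nat assume st: "s < 2" "t < 2"
    with rc have "2 * r + s < 2 * l" "2 * c + t < 2 * n" by linarith+
    then have "(cmat A * W) $$ (2 * r + s, 2 * c + t) =
        (\<Sum>k\<in>{0..<2 * m}. cmat A $$ (2 * r + s, k) * W $$ (k, 2 * c + t))"
      using A W by (simp add: scalar_prod_def)
    also have "\<dots> = (\<Sum>k\<in>{0..<m}. centry (A $$ (r, k)) s 0 * W $$ (2 * k + 0, 2 * c + t)
       + centry (A $$ (r, k)) s 1 * W $$ (2 * k + 1, 2 * c + t))"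
      unfolding sum_lessThan_double
      using index_cmat'[of r A _ s 0] index_cmat'[of r A _ s 1] A rc st
      by (intro sum.cong) auto
    finally show "(cmat A * W) $$ (2 * r + s, 2 * c + t) = \<dots>" .
  qed
  also have "\<dots> = (\<Sum>k\<in>{0..<m}. A $$ (r, k) *
      centry_retract (\<lambda>s t. W $$ (2 * k + s, 2 * c + t)))"
    unfolding centry_retract_sum
    using centry_retract_mult_left[of _ "\<lambda>s t. W $$ (2 * _ + s, 2 * c + t)"] by simp
  finally show "cmat_retract l n (cmat A * W) $$ (r, c) = (A * cmat_retract m n W) $$ (r, c)"
    using A rc by (simp add: cmat_retract_def scalar_prod_def)
qed (use A in \<open>auto simp: cmat_retract_def\<close>)

lemma cmat_retract_mult_right:
  assumes A: "A \<in> carrier_mat m n" and W: "W \<in> carrier_mat (2 * l) (2 * m)"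
  shows "cmat_retract l n (W * cmat A) = cmat_retract l m W * A"
proof (rule eq_matI)
  fix r c assume "r < dim_row (cmat_retract l m W * A)" "c < dim_col (cmat_retract l m W * A)"
  then have rc: "r < l" "c < n" using A by (auto simp: cmat_retract_def)
  have "centry_retract (\<lambda>s t. (W * cmat A) $$ (2 * r + s, 2 * c + t)) =
    centry_retract (\<lambda>s t. \<Sum>k\<in>{0..<m}. W $$ (2 * r + s, 2 * k + 0) * centry (A $$ (k, c)) 0 t
       + W $$ (2 * r + s, 2 * k + 1) * centry (A $$ (k, c)) 1 t)"
  proof (rule centry_retract_cong)
    fix s t :: nat assume st: "s < 2" "t < 2"
    with rc have "2 * r + s < 2 * l" "2 * c + t < 2 * n" by linarith+
    then have "(W * cmat A) $$ (2 * r + s, 2 * c + t) =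
        (\<Sum>k\<in>{0..<2 * m}. W $$ (2 * r + s, k) * cmat A $$ (k, 2 * c + t))"
      using A W by (simp add: scalar_prod_def)
    also have "\<dots> = (\<Sum>k\<in>{0..<m}. W $$ (2 * r + s, 2 * k + 0) * centry (A $$ (k, c)) 0 t
       + W $$ (2 * r + s, 2 * k + 1) * centry (A $$ (k, c)) 1 t)"
      unfolding sum_lessThan_double
      using index_cmat'[of _ A c 0 t] index_cmat'[of _ A c 1 t] A rc st
      by (intro sum.cong) auto
    finally show "(W * cmat A) $$ (2 * r + s, 2 * c + t) = \<dots>" .
  qed
  also have "\<dots> = (\<Sum>k\<in>{0..<m}. centry_retract (\<lambda>s t. W $$ (2 * r + s, 2 * k + t)) *
      A $$ (k, c))"
    unfolding centry_retract_sum
    using centry_retract_mult_right[of "\<lambda>s t. W $$ (2 * r + s, 2 * _ + t)"] by simp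
  finally show "cmat_retract l n (W * cmat A) $$ (r, c) = (cmat_retract l m W * A) $$ (r, c)"
    using A rc by (simp add: cmat_retract_def scalar_prod_def)
qed (use A in \<open>auto simp: cmat_retract_def\<close>)

lemma cmat_retract_one: "cmat_retract n n (1\<^sub>m (2 * n)) = 1\<^sub>m n"
proof (rule eq_matI)
  fix k l assume "k < dim_row (1\<^sub>m n :: quat mat)" "l < dim_col (1\<^sub>m n :: quat mat)"
  then have kl: "k < n" "l < n" by auto
  have "centry_retract (\<lambda>s t. 1\<^sub>m (2 * n) $$ (2 * k + s, 2 * l + t)) =
      centry_retract (\<lambda>s t. of_bool (k = l \<and> s = t))"
  proof (rule centry_retract_cong)
    fix s t :: nat assume st: "s < 2" "t < 2"
    with kl have "2 * k + s < 2 * n" "2 * l + t < 2 * n" by linarith+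
    then show "1\<^sub>m (2 * n) $$ (2 * k + s, 2 * l + t) = of_bool (k = l \<and> s = t)"
      using st by (simp add: double_add_eq_iff)
  qed
  also have "\<dots> = of_bool (k = l)" by (simp add: centry_retract_def quat_eq_iff)
  finally show "cmat_retract n n (1\<^sub>m (2 * n)) $$ (k, l) = 1\<^sub>m n $$ (k, l)"
    using kl by (simp add: cmat_retract_def)
qed (auto simp: cmat_retract_def)

text \<open>The inverse over the complex numbers is brought back to the quaternions by a retraction of
  the complex \<open>2 \<times> 2\<close> matrices onto the quaternions that is a map of quaternion bimodules.\<close>

lemma study_norm_nonzero_imp_inverse:
  assumes A: "A \<in> carrier_mat n n" and "study_norm A \<noteq> 0"
  obtains V where "V \<in> carrier_mat n n" "A * V = 1\<^sub>m n" "V * A = 1\<^sub>m n"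
proof -
  let ?C = "cmat A"
  define W where "W = (1 / det ?C) \<cdot>\<^sub>m adj_mat ?C"
  have C: "?C \<in> carrier_mat (2 * n) (2 * n)" using A by simp
  have d: "det ?C \<noteq> 0" using assms by (simp add: study_norm_def)
  have W: "W \<in> carrier_mat (2 * n) (2 * n)" using adj_mat(1)[OF C] by (simp add: W_def)
  have "?C * W = 1\<^sub>m (2 * n)" "W * ?C = 1\<^sub>m (2 * n)"
    using adj_mat[OF C] C d
    by (auto simp: W_def mult_smult_distrib[OF C adj_mat(1)[OF C]]
        mult_smult_assoc_mat[OF adj_mat(1)[OF C] C] intro!: eq_matI)
  then have "A * cmat_retract n n W = 1\<^sub>m n" "cmat_retract n n W * A = 1\<^sub>m n"
    using cmat_retract_mult_left[OF A W] cmat_retract_mult_right[OF A W]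
    by (simp_all add: cmat_retract_one)
  then show ?thesis using that[of "cmat_retract n n W"] by simp
qed

lemma inverse_imp_study_norm_nonzero:
  assumes "A \<in> carrier_mat n n" "V \<in> carrier_mat n n" "A * V = 1\<^sub>m n"
  shows "study_norm A \<noteq> 0"
proof
  assume "study_norm A = 0"
  then have "study_norm (A * V) = 0" using study_norm_mult[OF assms(1,2)] by simp
  then show False using assms by simp
qed

section \<open>Minors indexed by sets of rows and columns\<close>

text \<open>Submatrices keep their row and column indices by being written as arrays restricted to lists
  of indices.\<close>

definition lmat :: "('i \<Rightarrow> 'j \<Rightarrow> 'a) \<Rightarrow> 'i list \<Rightarrow> 'j list \<Rightarrow> 'a mat" where
  "lmat f rs cs = mat (length rs) (length cs) (\<lambda>(a, b). f (rs ! a) (cs ! b))"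

lemma lmat_carrier [simp]: "lmat f rs cs \<in> carrier_mat (length rs) (length cs)"
  by (simp add: lmat_def)

lemma lmat_carrier': "length rs = m \<Longrightarrow> length cs = n \<Longrightarrow> lmat f rs cs \<in> carrier_mat m n"
  by (simp add: lmat_def)

lemma dim_lmat [simp]: "dim_row (lmat f rs cs) = length rs" "dim_col (lmat f rs cs) = length cs"
  by (simp_all add: lmat_def)

lemma index_lmat [simp]:
  "a < length rs \<Longrightarrow> b < length cs \<Longrightarrow> lmat f rs cs $$ (a, b) = f (rs ! a) (cs ! b)"
  by (simp add: lmat_def)

lemma lmat_cong:
  "(\<And>x y. x \<in> set rs \<Longrightarrow> y \<in> set cs \<Longrightarrow> f x y = g x y) \<Longrightarrow> lmat f rs cs = lmat g rs cs"
  by (rule eq_matI) auto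

lemma lmat_mult:
  fixes f :: "'i \<Rightarrow> 'j \<Rightarrow> 'a :: semiring_0"
  assumes "distinct ms"
  shows "lmat f rs ms * lmat g ms cs = lmat (\<lambda>x y. \<Sum>k\<in>set ms. f x k * g k y) rs cs"
proof (rule eq_matI)
  fix a b assume ab: "a < dim_row (lmat (\<lambda>x y. \<Sum>k\<in>set ms. f x k * g k y) rs cs)"
    "b < dim_col (lmat (\<lambda>x y. \<Sum>k\<in>set ms. f x k * g k y) rs cs)"
  have "(\<Sum>k\<in>set ms. f (rs ! a) k * g k (cs ! b)) =
      (\<Sum>k<length ms. f (rs ! a) (ms ! k) * g (ms ! k) (cs ! b))"
    by (rule sum.reindex_bij_betw[symmetric]) (rule bij_betw_nth[OF assms], auto)
  then show "(lmat f rs ms * lmat g ms cs) $$ (a, b) =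
      lmat (\<lambda>x y. \<Sum>k\<in>set ms. f x k * g k y) rs cs $$ (a, b)"
    using ab by (simp add: scalar_prod_def lessThan_atLeast0)
qed auto

lemma lmat_delta:
  assumes "distinct rs"
  shows "lmat (\<lambda>x y. of_bool (x = y)) rs rs = 1\<^sub>m (length rs)"
  by (rule eq_matI) (use assms in \<open>auto simp: nth_eq_iff_index_eq\<close>)

lemma lmat_Cons:
  "lmat f (i # rs) (j # cs) =
     four_block_mat (mat 1 1 (\<lambda>_. f i j)) (lmat f [i] cs) (lmat f rs [j]) (lmat f rs cs)"
  by (rule eq_matI) (auto simp: nth_Cons')

lemma the_index:
  "distinct xs \<Longrightarrow> i < length xs \<Longrightarrow> (THE a. a < length xs \<and> xs ! a = xs ! i) = i"
  by (rule the_equality) (auto simp: nth_eq_iff_index_eq)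

text \<open>Distinct indices determine their positions, so any matrix can be read as an
  array.\<close>

lemma exists_lmat:
  assumes W: "W \<in> carrier_mat (length rs) (length cs)" and d: "distinct rs" "distinct cs"
  obtains M where "lmat M rs cs = W"
proof
  show "lmat (\<lambda>x y. W $$ (THE a. a < length rs \<and> rs ! a = x, THE b. b < length cs \<and> cs ! b = y)) rs cs = W"
    using W d by (intro eq_matI) (auto simp: the_index)
qed

lemma sum_of_bool_mult:
  fixes g :: "'i \<Rightarrow> 'a :: semiring_1"
  assumes "finite A" "x \<in> A"
  shows "(\<Sum>k\<in>A. of_bool (x = k) * g k) = g x" "(\<Sum>k\<in>A. g k * of_bool (k = x)) = g x"
proof -
  have "(\<Sum>k\<in>A. of_bool (x = k) * g k) = (\<Sum>k\<in>A. if x = k then g k else 0)"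
    "(\<Sum>k\<in>A. g k * of_bool (k = x)) = (\<Sum>k\<in>A. if x = k then g k else 0)"
    by (intro sum.cong; auto)+
  then show "(\<Sum>k\<in>A. of_bool (x = k) * g k) = g x" "(\<Sum>k\<in>A. g k * of_bool (k = x)) = g x"
    using assms by simp_all
qed

text \<open>A permutation matrix: its inverse is its transpose, which has the same norm, so the
  square of the norm is 1.\<close>

lemma study_norm_reindex:
  assumes "distinct xs" "distinct ys" "set xs = set ys"
  shows "study_norm (lmat (\<lambda>x y. of_bool (x = y)) xs ys) = 1"
proof -
  let ?Q = "lmat (\<lambda>x y. of_bool (x = y) :: quat)"
  have l: "length xs = length ys" using assms by (metis distinct_card)
  have Q: "?Q xs ys \<in> carrier_mat (length xs) (length xs)" "?Q ys xs \<in> carrier_mat (length xs) (length xs)"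
    by (intro lmat_carrier' l refl l[symmetric])+
  have "?Q xs ys * ?Q ys xs = 1\<^sub>m (length xs)"
    unfolding lmat_mult[OF assms(2)] lmat_delta[OF assms(1), symmetric]
    using assms(3) by (intro lmat_cong) (simp add: sum_of_bool_mult)
  then have "study_norm (?Q xs ys) * study_norm (?Q ys xs) = 1"
    using study_norm_mult[OF Q(1) Q(2)] study_norm_one[of "length xs"] by (simp only:)
  moreover have "cmat (?Q ys xs) = transpose_mat (cmat (?Q xs ys))"
  proof (rule cmat_eqI[of _ "length ys" "length xs"])
    fix k j s t :: nat assume kl: "k < length ys" "j < length xs" "s < 2" "t < 2"
    then have "2 * k + s < 2 * length ys" "2 * j + t < 2 * length xs" by linarith+
    moreover have "centry (of_bool (ys ! k = xs ! j)) s t = centry (of_bool (xs ! j = ys ! k)) t s"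
      using kl by (cases "xs ! j = ys ! k") (auto simp: centry_one)
    ultimately show "centry (?Q ys xs $$ (k, j)) s t = transpose_mat (cmat (?Q xs ys)) $$ (2 * k + s, 2 * j + t)"
      using kl index_cmat'[of j "?Q xs ys" k t s] by simp
  qed auto
  then have "study_norm (?Q ys xs) = study_norm (?Q xs ys)"
    using det_transpose[OF cmat_carrier[OF Q(1)]] by (simp only: study_norm_def)
  ultimately have "study_norm (?Q xs ys) ^ 2 = 1" by (simp add: power2_eq_square)
  moreover have "0 \<le> study_norm (?Q xs ys)" by (simp add: study_norm_def)
  ultimately show ?thesis by (simp add: power2_eq_1_iff)
qed

text \<open>Reordering multiplies by permutation matrices on both sides. So a minor depends only on
  its sets of rows and columns.\<close>

lemma study_norm_lmat_reorder:
  assumes rs: "distinct rs" "distinct rs'" "set rs' = set rs"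
    and cs: "distinct cs" "distinct cs'" "set cs' = set cs"
    and l: "length rs = length cs"
  shows "study_norm (lmat f rs' cs') = study_norm (lmat f rs cs)"
proof -
  let ?n = "length rs"
  define Q :: "quat mat" where "Q = lmat (\<lambda>x y. of_bool (x = y)) rs' rs"
  define P :: "quat mat" where "P = lmat (\<lambda>x y. of_bool (x = y)) cs cs'"
  define F where "F = lmat f rs cs"
  have len: "length rs' = ?n" "length cs' = ?n" using assms by (metis distinct_card)+
  have car: "Q \<in> carrier_mat ?n ?n" "F \<in> carrier_mat ?n ?n" "P \<in> carrier_mat ?n ?n"
    unfolding Q_def P_def F_def by (intro lmat_carrier' len refl l[symmetric])+
  have "lmat f rs' cs' = Q * (F * P)"
    unfolding Q_def P_def F_def lmat_mult[OF rs(1)] lmat_mult[OF cs(1)]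
    using assms(3,6) by (intro lmat_cong) (simp add: sum_of_bool_mult)
  also have "study_norm \<dots> = study_norm Q * (study_norm F * study_norm P)"
    using car by (simp add: study_norm_mult[of _ ?n])
  also have "study_norm Q = 1" unfolding Q_def by (rule study_norm_reindex[OF rs(2) rs(1) rs(3)])
  also have "study_norm P = 1" unfolding P_def by (rule study_norm_reindex[OF cs(1) cs(2) cs(3)[symmetric]])
  finally show ?thesis by (simp add: F_def)
qed

text \<open>For finite sets of equal size, sorting merely fixes an order;
  \<open>study_norm_lmat\<close> admits any other.\<close>

definition minor_norm :: "(nat \<Rightarrow> nat \<Rightarrow> quat) \<Rightarrow> nat set \<Rightarrow> nat set \<Rightarrow> real" where
  "minor_norm f I J = study_norm (lmat f (sorted_list_of_set I) (sorted_list_of_set J))"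

lemma study_norm_lmat:
  assumes "distinct rs" "distinct cs" "length rs = length cs"
  shows "study_norm (lmat f rs cs) = minor_norm f (set rs) (set cs)"
  unfolding minor_norm_def using assms
  by (intro study_norm_lmat_reorder) (auto simp: distinct_card)

lemma minor_norm_empty [simp]: "minor_norm f {} {} = 1"
  unfolding minor_norm_def study_norm_def
  by (subst det_dim_zero) (auto intro: carrier_matI)

section \<open>Two-sided inverses of submatrices and Schur complements\<close>

definition inverse_on :: "('i \<Rightarrow> 'j \<Rightarrow> 'a :: semiring_1) \<Rightarrow> 'i set \<Rightarrow> 'j set \<Rightarrow> ('j \<Rightarrow> 'i \<Rightarrow> 'a) \<Rightarrow> bool" where
  "inverse_on f I J M \<longleftrightarrow>
     (\<forall>i\<in>I. \<forall>k\<in>I. (\<Sum>j\<in>J. f i j * M j k) = of_bool (i = k)) \<and>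
     (\<forall>j\<in>J. \<forall>l\<in>J. (\<Sum>i\<in>I. M j i * f i l) = of_bool (j = l))"

lemma lmat_eq_iff:
  "lmat f rs cs = lmat g rs cs \<longleftrightarrow> (\<forall>x\<in>set rs. \<forall>y\<in>set cs. f x y = g x y)"
proof
  assume eq: "lmat f rs cs = lmat g rs cs"
  show "\<forall>x\<in>set rs. \<forall>y\<in>set cs. f x y = g x y"
  proof (intro ballI)
    fix x y assume "x \<in> set rs" "y \<in> set cs"
    then obtain a b where "a < length rs" "b < length cs" "x = rs ! a" "y = cs ! b"
      by (metis in_set_conv_nth)
    then show "f x y = g x y" using eq index_lmat by metis
  qed
qed (auto intro: lmat_cong)

lemma inverse_on_iff_lmat:
  assumes "distinct rs" "distinct cs"
  shows "inverse_on f (set rs) (set cs) M \<longleftrightarrow>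
    lmat f rs cs * lmat M cs rs = 1\<^sub>m (length rs) \<and> lmat M cs rs * lmat f rs cs = 1\<^sub>m (length cs)"
  unfolding lmat_mult[OF assms(1)] lmat_mult[OF assms(2)]
    lmat_delta[OF assms(1), symmetric] lmat_delta[OF assms(2), symmetric] lmat_eq_iff inverse_on_def ..

lemma minor_norm_nonzero_imp_inverse:
  assumes fin: "finite I" "finite J" and card: "card I = card J" and nz: "minor_norm f I J \<noteq> 0"
  obtains M where "inverse_on f I J M"
proof -
  let ?rs = "sorted_list_of_set I" and ?cs = "sorted_list_of_set J"
  have l: "length ?rs = length ?cs" using fin card by simp
  then have "lmat f ?rs ?cs \<in> carrier_mat (length ?rs) (length ?rs)" by (metis lmat_carrier)
  then obtain V where V: "V \<in> carrier_mat (length ?rs) (length ?rs)"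
    "lmat f ?rs ?cs * V = 1\<^sub>m (length ?rs)" "V * lmat f ?rs ?cs = 1\<^sub>m (length ?rs)"
    using study_norm_nonzero_imp_inverse nz unfolding minor_norm_def by metis
  moreover obtain M where "lmat M ?cs ?rs = V" using exists_lmat[of V ?cs ?rs] V l by auto
  ultimately have "inverse_on f (set ?rs) (set ?cs) M"
    using l by (subst inverse_on_iff_lmat) auto
  then show ?thesis using that fin by simp
qed

text \<open>Subtracting right multiples of the columns in \<open>J\<close> from column
  \<open>j\<close> clears it in the rows \<open>I\<close> and leaves the Schur complement at
  \<open>(i, j)\<close>. The operation is unipotent, so it preserves the norm.\<close>

lemma minor_norm_schur:
  assumes fin: "finite I" "finite J" and card: "card I = card J" and ij: "i \<notin> I" "j \<notin> J"
    and inv: "inverse_on f I J M"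
  shows "minor_norm f (insert i I) (insert j J) =
    nu (f i j - (\<Sum>l\<in>J. \<Sum>k\<in>I. f i l * M l k * f k j)) * minor_norm f I J"
proof -
  define rs where "rs = sorted_list_of_set I"
  define cs where "cs = sorted_list_of_set J"
  have rs: "distinct rs" "set rs = I" "length rs = card I" using fin by (simp_all add: rs_def)
  have cs: "distinct cs" "set cs = J" "length cs = card I" using fin card by (simp_all add: cs_def)
  \<comment> \<open>\<open>g\<close> carries out the column operation: its column \<open>j\<close>
    is the unit vector at \<open>j\<close> minus \<open>M\<close> times column \<open>j\<close> of
    \<open>f\<close>.\<close>
  define g where "g x y = (if x = y then 1 else if y = j then - (\<Sum>k\<in>I. M x k * f k j) else 0)" for x y
  define h where "h x y = (\<Sum>l\<in>set (j # cs). f x l * g l y)" for x y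
  let ?n = "card I"
  have hJ: "h x y = f x y" if "y \<in> J" for x y
  proof -
    have "h x y = (\<Sum>l\<in>insert j J. if l = y then f x y else 0)"
      unfolding h_def g_def using that ij cs by (intro sum.cong) auto
    then show ?thesis using that fin by simp
  qed
  have hj: "h x j = f x j - (\<Sum>l\<in>J. \<Sum>k\<in>I. f x l * M l k * f k j)" for x
  proof -
    have "h x j = f x j + (\<Sum>l\<in>J. f x l * g l j)"
      unfolding h_def using cs fin ij by (simp add: g_def)
    also have "(\<Sum>l\<in>J. f x l * g l j) = (\<Sum>l\<in>J. - (\<Sum>k\<in>I. f x l * M l k * f k j))"
      using ij by (intro sum.cong) (auto simp: g_def sum_distrib_left mult.assoc)
    finally show ?thesis by (simp add: sum_negf)
  qed
  have h0: "h x j = 0" if "x \<in> I" for x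
  proof -
    have "(\<Sum>l\<in>J. \<Sum>k\<in>I. f x l * M l k * f k j) = (\<Sum>k\<in>I. (\<Sum>l\<in>J. f x l * M l k) * f k j)"
      by (subst sum.swap) (simp add: sum_distrib_right)
    also have "\<dots> = (\<Sum>k\<in>I. if k = x then f x j else 0)"
      using inv that by (intro sum.cong) (auto simp: inverse_on_def)
    also have "\<dots> = f x j" using that fin by simp
    finally show ?thesis by (simp add: hj)
  qed
  have "lmat f (i # rs) (j # cs) * lmat g (j # cs) (j # cs) = lmat h (i # rs) (j # cs)"
    using cs ij by (subst lmat_mult) (auto simp: h_def)
  moreover have "lmat g (j # cs) (j # cs) =
      four_block_mat (1\<^sub>m 1) (0\<^sub>m 1 ?n) (lmat g cs [j]) (1\<^sub>m ?n)"
  proof -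
    have "lmat g cs cs = 1\<^sub>m ?n"
      unfolding cs(3)[symmetric] lmat_delta[OF cs(1), symmetric]
      using cs ij by (intro lmat_cong) (auto simp: g_def)
    moreover have "lmat g [j] cs = 0\<^sub>m 1 ?n"
      using cs ij by (intro eq_matI) (auto simp: g_def)
    moreover have "mat 1 1 (\<lambda>_. g j j) = 1\<^sub>m 1" by (intro eq_matI) (auto simp: g_def)
    ultimately show ?thesis by (simp add: lmat_Cons)
  qed
  moreover have "lmat h (i # rs) (j # cs) =
      four_block_mat (mat 1 1 (\<lambda>_. h i j)) (lmat h [i] cs) (0\<^sub>m ?n 1) (lmat f rs cs)"
  proof -
    have "lmat h rs cs = lmat f rs cs" using cs hJ by (intro lmat_cong) auto
    moreover have "lmat h rs [j] = 0\<^sub>m ?n 1"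
      using rs h0 by (intro eq_matI) auto
    ultimately show ?thesis by (simp add: lmat_Cons)
  qed
  ultimately have "study_norm (lmat f (i # rs) (j # cs)) * 1 = nu (h i j) * study_norm (lmat f rs cs)"
    using study_norm_mult[OF lmat_carrier' lmat_carrier', of "i # rs" "Suc ?n" "j # cs" "j # cs" "j # cs" f g]
      study_norm_lower_unipotent[OF lmat_carrier', of cs ?n "[j]" g]
      study_norm_upper_block[OF lmat_carrier' lmat_carrier', of "[i]" cs ?n rs cs "h i j" h f] rs(3) cs(3)
    by simp
  then show ?thesis using study_norm_lmat[of "i # rs" "j # cs" f] study_norm_lmat[of rs cs f] rs cs ij hj
    by simp
qed

section \<open>Norm and conjugation of single quaternions\<close>

lemma nu_mult: "nu (x * y) = nu x * nu y"
  unfolding nu_eq_inner norm_quat_def[symmetric] power2_norm_eq_inner[symmetric]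
  by (simp add: norm_mult power_mult_distrib)

lemma nu_minus [simp]: "nu (- x) = nu x"
  by (simp add: nu_eq_inner)

lemma qcnj_mult: "qcnj (x * y) = qcnj y * qcnj x"
  by (simp add: quat_eq_iff algebra_simps)

lemma qcnj_add: "qcnj (x + y) = qcnj x + qcnj y"
  by (simp add: quat_eq_iff)

lemma qcnj_scaleR: "qcnj (r *\<^sub>R x) = r *\<^sub>R qcnj x"
  by (simp add: quat_eq_iff)

lemma qcnj_qcnj [simp]: "qcnj (qcnj x) = x"
  by (simp add: quat_eq_iff)

lemma qcnj_zero [simp]: "qcnj 0 = 0" and qcnj_one [simp]: "qcnj 1 = 1"
  by (simp_all add: quat_eq_iff)

lemma qcnj_sum: "qcnj (sum f A) = (\<Sum>x\<in>A. qcnj (f x))"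
  by (induction A rule: infinite_finite_induct) (simp_all add: qcnj_add)

lemma mult_qcnj: "x * qcnj x = of_real (nu x)"
  by (simp add: of_real_nu)

section \<open>The recursion for quasideterminants of generic matrices\<close>

text \<open>\<open>row_kernel f J M i\<close> is the row vector with entry 1 at \<open>i\<close> that annihilates the columns in
  \<open>J\<close>, where \<open>M\<close> is the inverse of the remaining rows.\<close>

definition row_kernel :: "('i \<Rightarrow> 'j \<Rightarrow> 'a :: ring_1) \<Rightarrow> 'j set \<Rightarrow> ('j \<Rightarrow> 'i \<Rightarrow> 'a) \<Rightarrow> 'i \<Rightarrow> 'i \<Rightarrow> 'a" where
  "row_kernel f J M i m = (if m = i then 1 else - (\<Sum>l\<in>J. f i l * M l m))"

text \<open>With \<open>M\<close> the inverse of \<open>f\<close> on \<open>I \<times> J\<close>, this is the quasideterminant at \<open>(i, j)\<close> of the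
  submatrix with rows \<open>insert i I\<close> and columns \<open>insert j J\<close>.\<close>

definition schur_entry ::
    "('i \<Rightarrow> 'j \<Rightarrow> 'a :: ring_1) \<Rightarrow> 'i set \<Rightarrow> 'j set \<Rightarrow> ('j \<Rightarrow> 'i \<Rightarrow> 'a) \<Rightarrow> 'i \<Rightarrow> 'j \<Rightarrow> 'a" where
  "schur_entry f I J M i j = f i j - (\<Sum>l\<in>J. \<Sum>k\<in>I. f i l * M l k * f k j)"

lemma row_kernel_self [simp]: "row_kernel f J M i i = 1"
  by (simp add: row_kernel_def)

text \<open>Interchanging the two sums shows that, as \<open>j\<close> varies, all these Schur
  complements come from one kernel vector.\<close>

lemma schur_entry_eq_row_kernel:
  assumes "finite I" "i \<notin> I"
  shows "schur_entry f I J M i j = (\<Sum>m\<in>insert i I. row_kernel f J M i m * f m j)"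
proof -
  have "(\<Sum>m\<in>I. row_kernel f J M i m * f m j) = (\<Sum>m\<in>I. - (\<Sum>l\<in>J. f i l * M l m * f m j))"
    using assms by (intro sum.cong) (auto simp: row_kernel_def sum_distrib_right)
  also have "\<dots> = - (\<Sum>l\<in>J. \<Sum>m\<in>I. f i l * M l m * f m j)"
    by (subst sum.swap) (simp add: sum_negf)
  finally show ?thesis using assms by (simp add: schur_entry_def)
qed

lemma schur_entry_row:
  assumes fin: "finite I" and inv: "inverse_on f I J M" and x: "x \<in> I"
  shows "schur_entry f I J M x j = 0"
proof -
  have "(\<Sum>l\<in>J. \<Sum>k\<in>I. f x l * M l k * f k j) = (\<Sum>k\<in>I. (\<Sum>l\<in>J. f x l * M l k) * f k j)"
    by (subst sum.swap) (simp add: sum_distrib_right)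
  also have "\<dots> = (\<Sum>k\<in>I. of_bool (x = k) * f k j)"
    using inv x by (intro sum.cong) (auto simp: inverse_on_def)
  also have "\<dots> = f x j" using sum_of_bool_mult(1)[OF fin x, of "\<lambda>k. f k j"] .
  finally show ?thesis by (simp add: schur_entry_def)
qed

text \<open>\<open>M\<close> reproduces the columns in \<open>J\<close>. For \<open>i\<close>
  outside \<open>I\<close>, together with \<open>schur_entry_eq_row_kernel\<close>, this says that
  \<open>row_kernel\<close> annihilates them.\<close>

lemma schur_entry_column:
  assumes fin: "finite J" and inv: "inverse_on f I J M" and x: "x \<in> J"
  shows "schur_entry f I J M i x = 0"
proof -
  have "(\<Sum>l\<in>J. \<Sum>k\<in>I. f i l * M l k * f k x) = (\<Sum>l\<in>J. f i l * (\<Sum>k\<in>I. M l k * f k x))"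
    by (simp add: sum_distrib_left mult.assoc)
  also have "\<dots> = (\<Sum>l\<in>J. f i l * of_bool (l = x))"
    using inv x by (intro sum.cong) (auto simp: inverse_on_def)
  also have "\<dots> = f i x" using sum_of_bool_mult(2)[OF fin x, of "f i"] .
  finally show ?thesis by (simp add: schur_entry_def)
qed

text \<open>The left kernel is a line: multiplying the relation by \<open>M\<close> on the right
  expresses the entries on \<open>I\<close> through the entry at \<open>i\<close>.\<close>

lemma row_kernel_unique:
  assumes fin: "finite I" "finite J" and inv: "inverse_on f I J M" and i: "i \<notin> I"
    and x: "\<And>l. l \<in> J \<Longrightarrow> (\<Sum>m\<in>insert i I. x m * f m l) = 0" and m: "m \<in> insert i I"
  shows "x m = x i * row_kernel f J M i m"
proof (cases "m = i")
  case False
  with m have mI: "m \<in> I" by simp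
  have xl: "(\<Sum>k\<in>I. x k * f k l) = - (x i * f i l)" if "l \<in> J" for l
    using x[OF that] fin i by (simp add: eq_neg_iff_add_eq_0 add.commute)
  have "x m = (\<Sum>k\<in>I. x k * of_bool (k = m))"
    using sum_of_bool_mult(2)[OF fin(1) mI, of x] by simp
  also have "\<dots> = (\<Sum>k\<in>I. x k * (\<Sum>l\<in>J. f k l * M l m))"
    using inv mI by (intro sum.cong) (auto simp: inverse_on_def)
  also have "\<dots> = (\<Sum>k\<in>I. \<Sum>l\<in>J. x k * f k l * M l m)"
    by (simp add: sum_distrib_left mult.assoc)
  also have "\<dots> = (\<Sum>l\<in>J. (\<Sum>k\<in>I. x k * f k l) * M l m)"
    by (subst sum.swap) (simp add: sum_distrib_right)
  also have "\<dots> = (\<Sum>l\<in>J. x i * - (f i l * M l m))"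
    by (intro sum.cong) (auto simp: xl mult.assoc)
  also have "\<dots> = x i * row_kernel f J M i m"
    unfolding sum_distrib_left[symmetric] using False by (simp add: row_kernel_def sum_negf)
  finally show ?thesis .
qed simp

text \<open>Multiply column \<open>i\<close> of the identity \<open>f M' = 1\<close> by the kernel
  vector: the columns in \<open>J\<close> drop out, and only the quasideterminant times
  \<open>M' j i\<close> survives.\<close>

lemma inverse_entry_mult_schur_entry:
  fixes f :: "'i \<Rightarrow> 'j \<Rightarrow> 'a :: division_ring"
  assumes fin: "finite I" "finite J" and ij: "i \<notin> I" "j \<notin> J"
    and inv: "inverse_on f I J M" and inv': "inverse_on f (insert i I) (insert j J) M'"
  shows "M' j i * schur_entry f I J M i j = 1"
proof -
  let ?w = "row_kernel f J M i"
  have "1 = (\<Sum>m\<in>insert i I. ?w m * of_bool (m = i))"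
    using sum_of_bool_mult(2)[of "insert i I" i ?w] fin by simp
  also have "\<dots> = (\<Sum>m\<in>insert i I. ?w m * (\<Sum>l\<in>insert j J. f m l * M' l i))"
    using inv' by (intro sum.cong) (auto simp: inverse_on_def)
  also have "\<dots> = (\<Sum>m\<in>insert i I. \<Sum>l\<in>insert j J. ?w m * f m l * M' l i)"
    by (simp only: sum_distrib_left mult.assoc)
  also have "\<dots> = (\<Sum>l\<in>insert j J. schur_entry f I J M i l * M' l i)"
    by (subst sum.swap) (simp only: schur_entry_eq_row_kernel[OF fin(1) ij(1)] sum_distrib_right)
  also have "\<dots> = schur_entry f I J M i j * M' j i"
    using fin ij schur_entry_column[OF fin(2) inv] by simp
  finally have eq: "schur_entry f I J M i j * M' j i = 1" by simp
  then have "inverse (schur_entry f I J M i j) = M' j i" by (rule inverse_unique)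
  moreover have "schur_entry f I J M i j \<noteq> 0" using eq by auto
  ultimately show ?thesis by (metis left_inverse)
qed

section \<open>Quasideterminants and minors of generic arrays\<close>

definition inverse_of :: "(nat \<Rightarrow> nat \<Rightarrow> quat) \<Rightarrow> nat set \<Rightarrow> nat set \<Rightarrow> nat \<Rightarrow> nat \<Rightarrow> quat" where
  "inverse_of f I J = (SOME M. inverse_on f I J M)"

text \<open>For \<open>i\<close> outside \<open>I\<close> and \<open>j\<close> outside
  \<open>J\<close> this is a quasideterminant. If an inverse exists and an index is repeated, it
  vanishes.\<close>

definition quasi :: "(nat \<Rightarrow> nat \<Rightarrow> quat) \<Rightarrow> nat set \<Rightarrow> nat set \<Rightarrow> nat \<Rightarrow> nat \<Rightarrow> quat" where
  "quasi f I J = schur_entry f I J (inverse_of f I J)"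

locale generic_array =
  fixes f :: "nat \<Rightarrow> nat \<Rightarrow> quat" and n :: nat
  assumes minor_norm_nonzero:
    "I \<subseteq> {..<n} \<Longrightarrow> J \<subseteq> {..<n} \<Longrightarrow> card I = card J \<Longrightarrow> minor_norm f I J \<noteq> 0"
begin

lemma finite_index: "I \<subseteq> {..<n} \<Longrightarrow> finite I"
  by (rule finite_subset) auto

lemma inverse_of:
  assumes "I \<subseteq> {..<n}" "J \<subseteq> {..<n}" "card I = card J"
  shows "inverse_on f I J (inverse_of f I J)"
  using minor_norm_nonzero_imp_inverse[OF finite_index finite_index assms(3) minor_norm_nonzero] assms
  unfolding inverse_of_def by (metis someI_ex)

lemma minor_norm_insert:
  assumes "insert i I \<subseteq> {..<n}" "insert j J \<subseteq> {..<n}" "card I = card J" "i \<notin> I" "j \<notin> J"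
  shows "minor_norm f (insert i I) (insert j J) = nu (quasi f I J i j) * minor_norm f I J"
  unfolding quasi_def schur_entry_def
  using assms by (intro minor_norm_schur finite_index inverse_of) auto

text \<open>The kernel relation expresses row \<open>k\<close> through row \<open>m\<close> and the
  rows \<open>R\<close> common to both minors. Rows in \<open>R\<close> contribute nothing to a
  quasideterminant over \<open>R\<close>, so those of the rows \<open>k\<close> and \<open>m\<close>
  differ by a left factor, the negative of the kernel entry at \<open>m\<close>.\<close>

lemma minor_norm_exchange:
  assumes T: "T \<subseteq> {..<n}" and J: "J \<subseteq> {..<n}" and card: "card T = Suc (card J)"
    and km: "k \<in> T" "m \<in> T" "k \<noteq> m"
  shows "minor_norm f (T - {m}) J =
    nu (row_kernel f J (inverse_of f (T - {k}) J) k m) * minor_norm f (T - {k}) J"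
proof -
  have fin: "finite T" "finite J" using T J by (auto intro: finite_index)
  define R where "R = T - {k, m}"
  have Tk: "T - {m} = insert k R" and Tm: "T - {k} = insert m R" and R: "k \<notin> R" "m \<notin> R" "finite R"
    using km fin by (auto simp: R_def)
  have cR: "Suc (card R) = card J" using card fin R km Tm by (metis card_Suc_Diff1 card_insert_disjoint nat.inject)
  \<comment> \<open>\<open>T\<close> has at least two rows, so \<open>J\<close> is nonempty; any of
    its columns serves for expanding both minors.\<close>
  then obtain j where j: "j \<in> J" by (metis card.empty ex_in_conv nat.distinct(1))
  define J0 where "J0 = J - {j}"
  have J0: "J = insert j J0" "j \<notin> J0" "card R = card J0" "finite J0"
    using j cR fin by (auto simp: J0_def)
  let ?M = "inverse_of f R J0" and ?w = "row_kernel f J (inverse_of f (T - {k}) J) k"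
  let ?g = "\<lambda>x. schur_entry f R J0 ?M x j"
  have sub: "R \<subseteq> {..<n}" "J0 \<subseteq> {..<n}" using T J by (auto simp: R_def J0_def)
  have inv: "inverse_on f R J0 ?M" using inverse_of sub J0 by auto
  have inv': "inverse_on f (T - {k}) J (inverse_of f (T - {k}) J)"
    using T J card km fin by (intro inverse_of) auto
  \<comment> \<open>The kernel vector is 1 at \<open>k\<close>, so its relation can be solved for
    row \<open>k\<close>.\<close>
  have rel: "f k l = - (\<Sum>x\<in>insert m R. ?w x * f x l)" if "l \<in> J" for l
  proof -
    have "0 = schur_entry f (T - {k}) J (inverse_of f (T - {k}) J) k l"
      using schur_entry_column[OF fin(2) inv' that] by simp
    also have "\<dots> = (\<Sum>x\<in>insert k (insert m R). ?w x * f x l)"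
      using R km by (simp add: Tm schur_entry_eq_row_kernel)
    also have "\<dots> = f k l + (\<Sum>x\<in>insert m R. ?w x * f x l)"
      using R km(3) by (subst sum.insert) auto
    finally show ?thesis by (simp add: eq_neg_iff_add_eq_0)
  qed
  let ?c = "\<lambda>l. \<Sum>r\<in>R. ?M l r * f r j"
  have g: "?g x = f x j - (\<Sum>l\<in>J0. f x l * ?c l)" for x
    by (simp add: schur_entry_def sum_distrib_left mult.assoc)
  \<comment> \<open>A quasideterminant is left linear in its row, so \<open>rel\<close> carries over
    to \<open>?g\<close>.\<close>
  have "?g k = - (\<Sum>x\<in>insert m R. ?w x * f x j) + (\<Sum>l\<in>J0. (\<Sum>x\<in>insert m R. ?w x * f x l) * ?c l)"
    unfolding g using J0 by (simp add: rel sum_negf)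
  also have "(\<Sum>l\<in>J0. (\<Sum>x\<in>insert m R. ?w x * f x l) * ?c l) =
      (\<Sum>x\<in>insert m R. ?w x * (\<Sum>l\<in>J0. f x l * ?c l))"
    unfolding sum_distrib_right[of _ "insert m R"] sum_distrib_left[of _ _ J0]
    by (subst sum.swap) (simp only: mult.assoc)
  also have "- (\<Sum>x\<in>insert m R. ?w x * f x j) + \<dots> = - (\<Sum>x\<in>insert m R. ?w x * ?g x)"
    unfolding g by (simp only: right_diff_distrib sum_subtractf) simp
  also have "(\<Sum>x\<in>insert m R. ?w x * ?g x) = ?w m * ?g m"
    using R schur_entry_row[OF R(3) inv] by simp
  finally have "nu (quasi f R J0 k j) = nu (?w m) * nu (quasi f R J0 m j)"
    by (simp add: quasi_def nu_mult)
  moreover have "minor_norm f (insert k R) (insert j J0) = nu (quasi f R J0 k j) * minor_norm f R J0"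
    "minor_norm f (insert m R) (insert j J0) = nu (quasi f R J0 m j) * minor_norm f R J0"
    using R J0 T J km by (auto intro!: minor_norm_insert simp: R_def)
  ultimately show ?thesis by (simp add: Tk Tm J0(1))
qed

text \<open>The two kernel vectors span the same left line, so they differ by the factor
  \<open>w k m\<close>, and \<open>minor_norm_exchange\<close> gives the square of its length.\<close>

lemma row_kernel_hermitian:
  assumes T: "T \<subseteq> {..<n}" and J: "J \<subseteq> {..<n}" and card: "card T = Suc (card J)"
    and km: "k \<in> T" "m \<in> T"
  shows "minor_norm f (T - {k}) J *\<^sub>R row_kernel f J (inverse_of f (T - {k}) J) k m =
    minor_norm f (T - {m}) J *\<^sub>R qcnj (row_kernel f J (inverse_of f (T - {m}) J) m k)"
proof (cases "k = m")
  case False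
  have fin: "finite T" "finite J" using T J by (auto intro: finite_index)
  let ?w = "\<lambda>k. row_kernel f J (inverse_of f (T - {k}) J) k"
  have inv: "inverse_on f (T - {x}) J (inverse_of f (T - {x}) J)" if "x \<in> T" for x
    using T J card that fin by (intro inverse_of) auto
  have "(\<Sum>x\<in>insert k (T - {k}). ?w m x * f x l) = 0" if "l \<in> J" for l
    using schur_entry_column[OF fin(2) inv[OF km(2)] that, of m] fin
      schur_entry_eq_row_kernel[of "T - {m}" m f J _ l] km
    by (simp add: insert_absorb)
  then have "?w m m = ?w m k * ?w k m"
    using km fin by (intro row_kernel_unique[OF _ _ inv[OF km(1)]]) auto
  then have "?w m k * ?w k m = 1" by simp
  then have "?w k m * qcnj (?w m k * ?w k m) = ?w k m" by simp
  then have "nu (?w k m) *\<^sub>R qcnj (?w m k) = ?w k m"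
    by (simp add: qcnj_mult mult.assoc[symmetric] mult_qcnj scaleR_conv_of_real)
  then show ?thesis
    using minor_norm_exchange[OF T J card km False] by (metis mult.commute scaleR_scaleR)
qed simp

text \<open>Writing each quasideterminant as kernel vector times column turns both sides into double
  sums of \<open>qcnj (f m l)\<close>, a coefficient and \<open>f k j\<close>. The coefficients
  agree by \<open>row_kernel_hermitian\<close>.\<close>

lemma quasi_exchange:
  assumes T: "T \<subseteq> {..<n}" and J: "J \<subseteq> {..<n}" and card: "card T = Suc (card J)"
  shows "(\<Sum>k\<in>T. minor_norm f (T - {k}) J *\<^sub>R (qcnj (quasi f (T - {k}) J k l) * f k j)) =
    (\<Sum>k\<in>T. minor_norm f (T - {k}) J *\<^sub>R (qcnj (f k l) * quasi f (T - {k}) J k j))"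
proof -
  have fin: "finite T" using T by (auto intro: finite_index)
  let ?w = "\<lambda>k. row_kernel f J (inverse_of f (T - {k}) J) k"
  let ?N = "\<lambda>k. minor_norm f (T - {k}) J"
  have q: "quasi f (T - {k}) J k y = (\<Sum>m\<in>T. ?w k m * f m y)" if "k \<in> T" for k y
    using schur_entry_eq_row_kernel[of "T - {k}" k f J _ y] fin that
    by (simp add: quasi_def insert_absorb)
  have "(\<Sum>k\<in>T. ?N k *\<^sub>R (qcnj (quasi f (T - {k}) J k l) * f k j)) =
      (\<Sum>k\<in>T. \<Sum>m\<in>T. qcnj (f m l) * (?N k *\<^sub>R qcnj (?w k m)) * f k j)"
    by (intro sum.cong)
       (simp_all add: q qcnj_sum qcnj_mult sum_distrib_right scaleR_sum_right mult.assoc)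
  also have "\<dots> = (\<Sum>k\<in>T. \<Sum>m\<in>T. qcnj (f m l) * (?N m *\<^sub>R ?w m k) * f k j)"
    by (intro sum.cong refl) (simp add: row_kernel_hermitian[OF T J card])
  also have "\<dots> = (\<Sum>m\<in>T. \<Sum>k\<in>T. qcnj (f m l) * (?N m *\<^sub>R ?w m k) * f k j)"
    by (rule sum.swap)
  also have "\<dots> = (\<Sum>m\<in>T. ?N m *\<^sub>R (qcnj (f m l) * quasi f (T - {m}) J m j))"
    by (intro sum.cong)
       (simp_all add: q sum_distrib_left scaleR_sum_right mult.assoc)
  finally show ?thesis .
qed

text \<open>The inverse of a nonzero quaternion is its conjugate divided by \<open>nu\<close>, and
  \<open>nu\<close> of this quasideterminant is the ratio of the two minors.\<close>

lemma minor_norm_inverse_of: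
  assumes "I \<subseteq> {..<n}" "J \<subseteq> {..<n}" "card I = card J" "k \<in> I" "l \<in> J"
  shows "minor_norm f I J *\<^sub>R inverse_of f I J l k =
    minor_norm f (I - {k}) (J - {l}) *\<^sub>R qcnj (quasi f (I - {k}) (J - {l}) k l)"
proof -
  have fin: "finite I" "finite J" using assms by (auto intro: finite_index)
  let ?q = "quasi f (I - {k}) (J - {l}) k l"
  have c: "card (I - {k}) = card (J - {l})" using assms fin by simp
  have "inverse_of f I J l k * ?q = 1"
    unfolding quasi_def using assms c fin
    by (intro inverse_entry_mult_schur_entry inverse_of) (auto simp: insert_absorb intro!: inverse_of)
  then have "inverse_of f I J l k * (?q * qcnj ?q) = qcnj ?q" by (simp add: mult.assoc[symmetric])
  then have "nu ?q *\<^sub>R inverse_of f I J l k = qcnj ?q"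
    by (simp add: mult_qcnj scaleR_conv_of_real) (simp add: of_real_def)
  moreover have "minor_norm f I J = nu ?q * minor_norm f (I - {k}) (J - {l})"
    using minor_norm_insert[of k "I - {k}" l "J - {l}"] assms c
    by (simp add: insert_absorb subset_iff)
  ultimately show ?thesis by (metis mult.commute scaleR_scaleR)
qed

text \<open>The scaled entries of the inverse are conjugated quasideterminants. For each column
  \<open>l\<close>, \<open>quasi_exchange\<close> moves the conjugation to \<open>f k l\<close>,
  which gives the shape of the combinatorial recursion.\<close>

lemma quasi_recursion:
  assumes IJ: "I \<subseteq> {..<n}" "J \<subseteq> {..<n}" "card I = card J"
  shows "minor_norm f I J *\<^sub>R quasi f I J i j = minor_norm f I J *\<^sub>R f i j -
    (\<Sum>l\<in>J. \<Sum>k\<in>I. f i l * qcnj (f k l) *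
       (minor_norm f (I - {k}) (J - {l}) *\<^sub>R quasi f (I - {k}) (J - {l}) k j))"
proof -
  have fin: "finite I" "finite J" using assms by (auto intro: finite_index)
  have "minor_norm f I J *\<^sub>R (\<Sum>l\<in>J. \<Sum>k\<in>I. f i l * inverse_of f I J l k * f k j) =
    (\<Sum>l\<in>J. \<Sum>k\<in>I. f i l * (minor_norm f I J *\<^sub>R inverse_of f I J l k) * f k j)"
    by (simp add: scaleR_sum_right)
  also have "\<dots> = (\<Sum>l\<in>J. f i l * (\<Sum>k\<in>I. minor_norm f (I - {k}) (J - {l}) *\<^sub>R
      (qcnj (quasi f (I - {k}) (J - {l}) k l) * f k j)))"
    by (simp add: minor_norm_inverse_of[OF IJ] sum_distrib_left mult.assoc)
  also have "\<dots> = (\<Sum>l\<in>J. f i l * (\<Sum>k\<in>I. minor_norm f (I - {k}) (J - {l}) *\<^sub>R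
      (qcnj (f k l) * quasi f (I - {k}) (J - {l}) k j)))"
  proof (rule sum.cong[OF refl])
    fix l assume "l \<in> J"
    then have "card I = Suc (card (J - {l}))" "J - {l} \<subseteq> {..<n}"
      using IJ card_Suc_Diff1[OF fin(2)] by auto
    from quasi_exchange[OF IJ(1) this(2,1)] show
      "f i l * (\<Sum>k\<in>I. minor_norm f (I - {k}) (J - {l}) *\<^sub>R
        (qcnj (quasi f (I - {k}) (J - {l}) k l) * f k j)) =
       f i l * (\<Sum>k\<in>I. minor_norm f (I - {k}) (J - {l}) *\<^sub>R
        (qcnj (f k l) * quasi f (I - {k}) (J - {l}) k j))" by simp
  qed
  also have "\<dots> = (\<Sum>l\<in>J. \<Sum>k\<in>I. f i l * qcnj (f k l) *
       (minor_norm f (I - {k}) (J - {l}) *\<^sub>R quasi f (I - {k}) (J - {l}) k j))"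
    by (simp add: sum_distrib_left mult.assoc)
  finally show ?thesis by (simp add: quasi_def schur_entry_def scaleR_diff_right)
qed

end

section \<open>Expansion into zigzag monomials\<close>

text \<open>The monomial \<open>m\<^bsub>I,J\<^esub>\<close> with \<open>I = (i, us)\<close> and \<open>J = (j, vs)\<close>.\<close>

fun zigzag :: "(nat \<Rightarrow> nat \<Rightarrow> quat) \<Rightarrow> nat \<Rightarrow> nat \<Rightarrow> nat list \<Rightarrow> nat list \<Rightarrow> quat" where
  "zigzag f i j (k # us) (l # vs) = f i l * qcnj (f k l) * zigzag f k j us vs"
| "zigzag f i j _ _ = f i j"

text \<open>Only what follows \<open>i\<close> and \<open>j\<close> in the two orderings is
  recorded, for all orders of \<open>B\<close> at once.\<close>

definition index_paths :: "nat set \<Rightarrow> nat set \<Rightarrow> (nat list \<times> nat list) set" where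
  "index_paths I J = {(us, vs). distinct us \<and> distinct vs \<and> set us \<subseteq> I \<and> set vs \<subseteq> J \<and>
     length us = length vs}"

text \<open>The right-hand side of the theorem, with the submatrices \<open>B\<close> and the orderings of their rows and
  columns merged into one sum; \<open>I\<close> and \<open>J\<close> do not contain \<open>i\<close> and \<open>j\<close>.\<close>

definition cofactor_sum :: "(nat \<Rightarrow> nat \<Rightarrow> quat) \<Rightarrow> nat set \<Rightarrow> nat set \<Rightarrow> nat \<Rightarrow> nat \<Rightarrow> quat" where
  "cofactor_sum f I J i j = (\<Sum>(us, vs)\<in>index_paths I J.
     ((-1) ^ length us * minor_norm f (I - set us) (J - set vs)) *\<^sub>R zigzag f i j us vs)"

lemma finite_index_paths: "finite I \<Longrightarrow> finite J \<Longrightarrow> finite (index_paths I J)"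
  by (rule finite_subset[of _ "{us. set us \<subseteq> I \<and> distinct us} \<times> {vs. set vs \<subseteq> J \<and> distinct vs}"])
     (auto simp: index_paths_def intro!: finite_cartesian_product finite_subset_distinct)

lemma index_paths_unfold:
  "index_paths I J = insert ([], [])
     ((\<lambda>((l, k), us, vs). (k # us, l # vs)) `
       (SIGMA lk : J \<times> I. index_paths (I - {snd lk}) (J - {fst lk})))" (is "_ = ?R")
proof (rule subset_antisym; rule subrelI)
  fix us vs assume a: "(us, vs) \<in> index_paths I J"
  show "(us, vs) \<in> ?R"
  proof (cases us)
    case Nil
    then show ?thesis using a by (auto simp: index_paths_def)
  next
    case (Cons k us')
    with a obtain l vs' where "vs = l # vs'" by (cases vs) (auto simp: index_paths_def)
    with a Cons have "((l, k), us', vs') \<in> (SIGMA lk : J \<times> I. index_paths (I - {snd lk}) (J - {fst lk}))"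
      by (auto simp: index_paths_def)
    then show ?thesis using Cons \<open>vs = _\<close> by (intro insertI2 image_eqI) auto
  qed
next
  fix us vs assume "(us, vs) \<in> ?R"
  then show "(us, vs) \<in> index_paths I J" by (auto simp: index_paths_def)
qed

text \<open>Each first pair \<open>(k, l)\<close> contributes two factors and a sign, and what
  follows is a path avoiding \<open>k\<close> and \<open>l\<close>. The empty path gives the leading
  term.\<close>

lemma cofactor_sum_recursion:
  assumes fin: "finite I" "finite J"
  shows "cofactor_sum f I J i j = minor_norm f I J *\<^sub>R f i j -
    (\<Sum>l\<in>J. \<Sum>k\<in>I. f i l * qcnj (f k l) * cofactor_sum f (I - {k}) (J - {l}) k j)"
proof -
  define t where "t = (\<lambda>(us, vs). ((-1) ^ length us * minor_norm f (I - set us) (J - set vs)) *\<^sub>R zigzag f i j us vs)"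
  let ?h = "\<lambda>((l, k), us, vs). (k # us, l # vs)"
  let ?S = "SIGMA lk : J \<times> I. index_paths (I - {snd lk}) (J - {fst lk})"
  have inj: "inj_on ?h ?S" by (auto simp: inj_on_def)
  have finS: "finite ?S" using fin by (intro finite_SigmaI finite_index_paths) auto
  have "cofactor_sum f I J i j = sum t (insert ([], []) (?h ` ?S))"
    unfolding cofactor_sum_def t_def index_paths_unfold[of I J] ..
  also have "\<dots> = t ([], []) + sum t (?h ` ?S)"
    using finS by (intro sum.insert) auto
  also have "sum t (?h ` ?S) = (\<Sum>x\<in>?S. t (?h x))"
    by (rule sum.reindex_cong[OF inj refl refl])
  also have "\<dots> = (\<Sum>lk\<in>J \<times> I. \<Sum>p\<in>index_paths (I - {snd lk}) (J - {fst lk}). t (?h (lk, p)))"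
    using fin by (subst sum.Sigma) (auto intro!: finite_index_paths simp: case_prod_beta)
  also have "\<dots> = (\<Sum>lk\<in>J \<times> I. - (f i (fst lk) * qcnj (f (snd lk) (fst lk)) *
      cofactor_sum f (I - {snd lk}) (J - {fst lk}) (snd lk) j))"
    unfolding cofactor_sum_def sum_distrib_left sum_negf[symmetric]
    by (intro sum.cong) (clarsimp simp: t_def Diff_insert2[of _ _ "set _"])+
  also have "\<dots> = - (\<Sum>l\<in>J. \<Sum>k\<in>I. f i l * qcnj (f k l) * cofactor_sum f (I - {k}) (J - {l}) k j)"
    by (simp add: sum.cartesian_product sum_negf case_prod_beta)
  finally show ?thesis by (simp add: t_def)
qed

section \<open>The cofactor sum of a generic array\<close>

context generic_array
begin

text \<open>Strong induction on the order, as \<open>quasi_recursion\<close> and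
  \<open>cofactor_sum_recursion\<close> have the same form.\<close>

lemma cofactor_sum_eq_quasi:
  assumes "I \<subseteq> {..<n}" "J \<subseteq> {..<n}" "card I = card J"
  shows "cofactor_sum f I J i j = minor_norm f I J *\<^sub>R quasi f I J i j"
  using assms
proof (induction "card I" arbitrary: I J i j rule: less_induct)
  case less
  have fin: "finite I" "finite J" using less.prems by (auto intro: finite_index)
  have "cofactor_sum f (I - {k}) (J - {l}) k j =
      minor_norm f (I - {k}) (J - {l}) *\<^sub>R quasi f (I - {k}) (J - {l}) k j"
    if "k \<in> I" "l \<in> J" for k l
    using that less.prems fin card_Diff1_less[OF fin(1) that(1)] by (intro less.hyps) auto
  then show ?case
    unfolding quasi_recursion[OF less.prems] cofactor_sum_recursion[OF fin] by simp
qed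

lemma qcnj_cofactor_sum:
  assumes IJ: "I \<subseteq> {..<n}" "J \<subseteq> {..<n}" "card I = card J" and kl: "k \<in> I" "l \<in> J"
  shows "qcnj (cofactor_sum f (I - {k}) (J - {l}) k l) = minor_norm f I J *\<^sub>R inverse_of f I J l k"
proof -
  have "cofactor_sum f (I - {k}) (J - {l}) k l =
      minor_norm f (I - {k}) (J - {l}) *\<^sub>R quasi f (I - {k}) (J - {l}) k l"
    using assms finite_index by (intro cofactor_sum_eq_quasi) auto
  then show ?thesis using minor_norm_inverse_of[OF IJ kl] by (simp add: qcnj_scaleR)
qed

text \<open>The adjugate identity, freed of inverses so that both sides are continuous in
  \<open>f\<close>.\<close>

lemma cofactor_sum_inverse_generic:
  assumes IJ: "I \<subseteq> {..<n}" "J \<subseteq> {..<n}" "card I = card J" and ik: "i \<in> I" "k \<in> I"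
  shows "(\<Sum>l\<in>J. f i l * qcnj (cofactor_sum f (I - {k}) (J - {l}) k l)) =
    minor_norm f I J *\<^sub>R of_bool (i = k)"
proof -
  have "(\<Sum>l\<in>J. f i l * qcnj (cofactor_sum f (I - {k}) (J - {l}) k l)) =
      minor_norm f I J *\<^sub>R (\<Sum>l\<in>J. f i l * inverse_of f I J l k)"
    by (simp add: qcnj_cofactor_sum[OF IJ ik(2)] scaleR_sum_right)
  also have "(\<Sum>l\<in>J. f i l * inverse_of f I J l k) = of_bool (i = k)"
    using inverse_of[OF IJ] ik by (simp add: inverse_on_def)
  finally show ?thesis .
qed

text \<open>The scaled Schur complement with the adjugate in place of the inverse. Unlike in
  \<open>cofactor_sum_recursion\<close>, the conjugation falls on the cofactor sum.\<close>

lemma cofactor_sum_expansion_generic: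
  assumes IJ: "I \<subseteq> {..<n}" "J \<subseteq> {..<n}" "card I = card J"
  shows "cofactor_sum f I J i j = minor_norm f I J *\<^sub>R f i j -
    (\<Sum>l\<in>J. \<Sum>k\<in>I. f i l * qcnj (cofactor_sum f (I - {k}) (J - {l}) k l) * f k j)"
  unfolding cofactor_sum_eq_quasi[OF IJ]
  by (simp add: qcnj_cofactor_sum[OF IJ] quasi_def schur_entry_def scaleR_diff_right scaleR_sum_right)

end

section \<open>Passage to the limit\<close>

lemma tendsto_det:
  fixes X :: "'b \<Rightarrow> 'a :: {comm_ring_1, real_normed_algebra_1} mat"
  assumes "\<And>m. X m \<in> carrier_mat n n" "A \<in> carrier_mat n n"
    and "\<And>i j. i < n \<Longrightarrow> j < n \<Longrightarrow> ((\<lambda>m. X m $$ (i, j)) \<longlongrightarrow> A $$ (i, j)) F"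
  shows "((\<lambda>m. det (X m)) \<longlongrightarrow> det A) F"
  unfolding det_def'[OF assms(1)] det_def'[OF assms(2)]
  using assms(3) by (intro tendsto_sum tendsto_mult tendsto_const tendsto_prod) auto

lemma tendsto_study_norm:
  assumes X: "\<And>m. X m \<in> carrier_mat n n" and A: "A \<in> carrier_mat n n"
    and lim: "\<And>i j. i < n \<Longrightarrow> j < n \<Longrightarrow> ((\<lambda>m. X m $$ (i, j)) \<longlongrightarrow> A $$ (i, j)) F"
  shows "((\<lambda>m. study_norm (X m)) \<longlongrightarrow> study_norm A) F"
  unfolding study_norm_def
proof (intro tendsto_norm tendsto_det)
  fix r c assume rc: "r < 2 * n" "c < 2 * n"
  then have "r div 2 < n" "c div 2 < n" by auto
  then have "((\<lambda>m. centry (X m $$ (r div 2, c div 2)) (r mod 2) (c mod 2)) \<longlongrightarrow>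
      centry (A $$ (r div 2, c div 2)) (r mod 2) (c mod 2)) F"
    by (intro tendsto_centry lim)
  moreover have "cmat (X m) $$ (r, c) = centry (X m $$ (r div 2, c div 2)) (r mod 2) (c mod 2)" for m
    using X[of m] rc by (intro index_cmat) auto
  moreover have "cmat A $$ (r, c) = centry (A $$ (r div 2, c div 2)) (r mod 2) (c mod 2)"
    using A rc by (intro index_cmat) auto
  ultimately show "((\<lambda>m. cmat (X m) $$ (r, c)) \<longlongrightarrow> cmat A $$ (r, c)) F" by simp
qed (use X A in auto)

lemma tendsto_minor_norm:
  assumes "\<And>i j. ((\<lambda>m. F m i j) \<longlongrightarrow> f i j) G" and card: "finite I" "finite J" "card I = card J"
  shows "((\<lambda>m. minor_norm (F m) I J) \<longlongrightarrow> minor_norm f I J) G"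
  unfolding minor_norm_def
  using assms by (intro tendsto_study_norm[of _ "card I"] lmat_carrier') auto

lemma tendsto_qcnj [tendsto_intros]: "(f \<longlongrightarrow> l) F \<Longrightarrow> ((\<lambda>x. qcnj (f x)) \<longlongrightarrow> qcnj l) F"
proof -
  \<comment> \<open>Conjugation is twice the real part minus the identity, both of which are
    continuous.\<close>
  have "qcnj x = (2 * qre x) *\<^sub>R 1 - x" for x by (simp add: quat_eq_iff)
  then show "(f \<longlongrightarrow> l) F \<Longrightarrow> ((\<lambda>x. qcnj (f x)) \<longlongrightarrow> qcnj l) F"
    by (simp only:) (intro tendsto_intros tendsto_qparts)
qed

lemma tendsto_zigzag:
  assumes "\<And>i j. ((\<lambda>m. F m i j) \<longlongrightarrow> f i j) G"
  shows "((\<lambda>m. zigzag (F m) i j us vs) \<longlongrightarrow> zigzag f i j us vs) G"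
proof (induction us arbitrary: i vs)
  case (Cons k us)
  then show ?case by (cases vs) (auto intro!: tendsto_intros assms)
qed (simp add: assms)

lemma card_Diff_index_paths:
  assumes "finite I" "finite J" "card I = card J" "(us, vs) \<in> index_paths I J"
  shows "card (I - set us) = card (J - set vs)"
  using assms by (auto simp: index_paths_def card_Diff_subset distinct_card)

lemma tendsto_cofactor_sum:
  assumes lim: "\<And>i j. ((\<lambda>m. F m i j) \<longlongrightarrow> f i j) G" and card: "finite I" "finite J" "card I = card J"
  shows "((\<lambda>m. cofactor_sum (F m) I J i j) \<longlongrightarrow> cofactor_sum f I J i j) G"
  unfolding cofactor_sum_def case_prod_beta using card card_Diff_index_paths[OF card]
  by (intro tendsto_intros tendsto_minor_norm tendsto_zigzag lim) auto

section \<open>Density of generic arrays\<close>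

lemma finite_minor_norm_zeros:
  assumes card: "finite I" "finite J" "card I = card J"
    and nz: "minor_norm (\<lambda>i j. f i j + s *\<^sub>R g i j) I J \<noteq> 0"
  shows "finite {t. minor_norm (\<lambda>i j. f i j + t *\<^sub>R g i j) I J = 0}"
proof -
  let ?rs = "sorted_list_of_set I" and ?cs = "sorted_list_of_set J"
  let ?N = "2 * card I"
  \<comment> \<open>Along the line \<open>f + t g\<close> the entries of the complex representation
    are polynomials of degree at most 1 in \<open>t\<close>. So the minor vanishes exactly at the
    real roots of \<open>det P\<close>, which is nonzero at \<open>s\<close>.\<close>
  define P where "P = mat ?N ?N (\<lambda>rc. [:cmat (lmat f ?rs ?cs) $$ rc, cmat (lmat g ?rs ?cs) $$ rc:])"
  have poly: "poly (det P) (of_real t) = det (cmat (lmat (\<lambda>i j. f i j + t *\<^sub>R g i j) ?rs ?cs))" for t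
  proof (rule poly_det_cong)
    show "cmat (lmat (\<lambda>i j. f i j + t *\<^sub>R g i j) ?rs ?cs) \<in> carrier_mat ?N ?N"
      using card by (intro cmat_carrier lmat_carrier') auto
    fix r c assume rc: "r < ?N" "c < ?N"
    then have "r div 2 < card I" "c div 2 < card J" "c < 2 * card J" using card by auto
    then show "poly (P $$ (r, c)) (of_real t) =
        cmat (lmat (\<lambda>i j. f i j + t *\<^sub>R g i j) ?rs ?cs) $$ (r, c)"
      using rc card by (simp add: P_def index_cmat centry_add centry_scaleR)
  qed (simp add: P_def)
  have zero: "minor_norm (\<lambda>i j. f i j + t *\<^sub>R g i j) I J = 0 \<longleftrightarrow> poly (det P) (of_real t) = 0" for t
    by (simp add: poly minor_norm_def study_norm_def)
  have "poly (det P) (of_real s) \<noteq> 0" using nz unfolding zero .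
  then have "det P \<noteq> 0" by (metis poly_0)
  then have "finite ((of_real :: real \<Rightarrow> complex) -` {z. poly (det P) z = 0})"
    by (intro finite_vimageI poly_roots_finite) (auto simp: inj_on_def)
  then show ?thesis unfolding zero by (simp add: vimage_def)
qed

lemma exists_minor_norm_nonzero:
  assumes card: "finite I" "finite J" "card I = card J"
  shows "\<exists>g. minor_norm g I J \<noteq> 0"
proof -
  let ?rs = "sorted_list_of_set I" and ?cs = "sorted_list_of_set J"
  \<comment> \<open>Pairing rows and columns in sorted order makes the submatrix the
    identity.\<close>
  define g where "g = (\<lambda>x y. of_bool (\<exists>a<card I. x = ?rs ! a \<and> y = ?cs ! a) :: quat)"
  have "lmat g ?rs ?cs = 1\<^sub>m (card I)"
    using card by (intro eq_matI) (auto simp: g_def nth_eq_iff_index_eq)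
  then have "minor_norm g I J = 1" by (simp add: minor_norm_def)
  then show ?thesis by (metis zero_neq_one)
qed

text \<open>Join an array that is good for \<open>S\<close> to one that is good for the new pair by
  a line. Each minor is nonzero at one of the two ends, so all but finitely many points of the line
  are good for every pair.\<close>

lemma exists_common_minor_norm_nonzero:
  assumes "finite S" "\<And>I J. (I, J) \<in> S \<Longrightarrow> finite I \<and> finite J \<and> card I = card J"
  shows "\<exists>g. \<forall>(I, J)\<in>S. minor_norm g I J \<noteq> 0"
  using assms
proof (induction S rule: finite_induct)
  case (insert x S)
  obtain I0 J0 where x: "x = (I0, J0)" by fastforce
  obtain g where g: "\<forall>(I, J)\<in>S. minor_norm g I J \<noteq> 0" using insert by auto
  obtain h where h: "minor_norm h I0 J0 \<noteq> 0"
    using exists_minor_norm_nonzero[of I0 J0] insert.prems[of I0 J0] x by auto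
  let ?l = "\<lambda>t i j. g i j + t *\<^sub>R (h i j - g i j)"
  have "finite {t. minor_norm (?l t) I J = 0}" if "(I, J) \<in> insert x S" for I J
  proof (rule finite_minor_norm_zeros)
    show "minor_norm (?l (if (I, J) = x then 1 else 0)) I J \<noteq> 0"
      using that g h x by auto
  qed (use insert.prems[OF that] in auto)
  then have "finite (\<Union>(I, J)\<in>insert x S. {t. minor_norm (?l t) I J = 0})"
    using insert.hyps by (intro finite_UN_I) (auto split: prod.splits)
  from ex_new_if_finite[OF infinite_UNIV_char_0 this]
  obtain t where "t \<notin> (\<Union>(I, J)\<in>insert x S. {t. minor_norm (?l t) I J = 0})" ..
  then show ?case by (intro exI[of _ "?l t"]) auto
qed simp

text \<open>On the line from \<open>f\<close> to an array without vanishing minors only finitely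
  many parameters are bad, so a tail of the sequence \<open>1 / (m + 1)\<close> avoids them.\<close>

lemma exists_generic_sequence:
  obtains F where "\<And>m :: nat. generic_array (F m) n" "\<And>i j. (\<lambda>m. F m i j) \<longlonglongrightarrow> f i j"
proof -
  define S where "S = {(I, J). I \<subseteq> {..<n} \<and> J \<subseteq> {..<n} \<and> card I = card J}"
  have S: "finite I \<and> finite J \<and> card I = card J" if "(I, J) \<in> S" for I J
    using that by (auto simp: S_def intro: finite_subset)
  have finS: "finite S"
    by (rule finite_subset[of _ "Pow {..<n} \<times> Pow {..<n}"]) (auto simp: S_def)
  then obtain g where g: "\<forall>(I, J)\<in>S. minor_norm g I J \<noteq> 0"
    using exists_common_minor_norm_nonzero S by metis
  let ?l = "\<lambda>t i j. f i j + t *\<^sub>R (g i j - f i j)"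
  define Z where "Z = (\<Union>(I, J)\<in>S. {t. minor_norm (?l t) I J = 0})"
  have "finite {t. minor_norm (?l t) I J = 0}" if "(I, J) \<in> S" for I J
    by (rule finite_minor_norm_zeros[where s = 1]) (use that g S in auto)
  then have "finite Z" using finS by (auto simp: Z_def)
  then have "finite ((\<lambda>m. inverse (real (Suc m))) -` Z)"
    by (rule finite_vimageI) (auto simp: inj_on_def)
  \<comment> \<open>The bad reciprocals have bounded index, so shifting by \<open>m0\<close> skips
    all of them.\<close>
  then obtain m0 where m0: "\<And>m. inverse (real (Suc m)) \<in> Z \<Longrightarrow> m < m0"
    by (metis (no_types, lifting) finite_nat_set_iff_bounded vimageI)
  define F where "F m = ?l (inverse (real (Suc (m + m0))))" for m
  show ?thesis
  proof
    show "generic_array (F m) n" for m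
    proof
      fix I J assume "I \<subseteq> {..<n}" "J \<subseteq> {..<n}" "card I = card J"
      moreover have "inverse (real (Suc (m + m0))) \<notin> Z" using m0[of "m + m0"] by auto
      ultimately show "minor_norm (F m) I J \<noteq> 0" unfolding F_def Z_def S_def by blast
    qed
    show "(\<lambda>m. F m i j) \<longlonglongrightarrow> f i j" for i j
    proof -
      have "(\<lambda>m. inverse (real (Suc (m + m0)))) \<longlonglongrightarrow> 0"
        by (rule LIMSEQ_ignore_initial_segment[OF LIMSEQ_inverse_real_of_nat])
      then have "(\<lambda>m. F m i j) \<longlonglongrightarrow> f i j + 0 *\<^sub>R (g i j - f i j)"
        unfolding F_def by (intro tendsto_intros)
      then show ?thesis by simp
    qed
  qed
qed

section \<open>The two inverse-free identities for arbitrary arrays\<close>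

lemma cofactor_sum_inverse:
  assumes fin: "finite I" "finite J" "card I = card J" and ik: "i \<in> I" "k \<in> I"
  shows "(\<Sum>l\<in>J. f i l * qcnj (cofactor_sum f (I - {k}) (J - {l}) k l)) =
    minor_norm f I J *\<^sub>R of_bool (i = k)"
proof -
  \<comment> \<open>Any common bound of the finite sets \<open>I\<close> and \<open>J\<close> can
    serve as the range on which the approximating arrays are generic.\<close>
  obtain n where "I \<union> J \<subseteq> {..<n}" using finite_nat_iff_bounded fin by (metis finite_UnI)
  then have n: "I \<subseteq> {..<n}" "J \<subseteq> {..<n}" by auto
  obtain F where F: "\<And>m :: nat. generic_array (F m) n" and lim: "\<And>i j. (\<lambda>m. F m i j) \<longlonglongrightarrow> f i j"
    using exists_generic_sequence by metis
  have "card (I - {k}) = card (J - {l})" if "l \<in> J" for l using that ik fin by simp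
  then have "(\<lambda>m. \<Sum>l\<in>J. F m i l * qcnj (cofactor_sum (F m) (I - {k}) (J - {l}) k l)) \<longlonglongrightarrow>
      (\<Sum>l\<in>J. f i l * qcnj (cofactor_sum f (I - {k}) (J - {l}) k l))"
    using fin by (intro tendsto_intros tendsto_cofactor_sum lim) auto
  moreover have "(\<lambda>m. \<Sum>l\<in>J. F m i l * qcnj (cofactor_sum (F m) (I - {k}) (J - {l}) k l)) \<longlonglongrightarrow>
      minor_norm f I J *\<^sub>R of_bool (i = k)"
    unfolding generic_array.cofactor_sum_inverse_generic[OF F n fin(3) ik]
    by (intro tendsto_scaleR tendsto_minor_norm[OF lim fin] tendsto_const)
  ultimately show ?thesis by (rule LIMSEQ_unique)
qed

lemma cofactor_sum_expansion:
  assumes fin: "finite I" "finite J" "card I = card J"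
  shows "cofactor_sum f I J i j = minor_norm f I J *\<^sub>R f i j -
    (\<Sum>l\<in>J. \<Sum>k\<in>I. f i l * qcnj (cofactor_sum f (I - {k}) (J - {l}) k l) * f k j)"
proof -
  obtain n where "I \<union> J \<subseteq> {..<n}" using finite_nat_iff_bounded fin by (metis finite_UnI)
  then have n: "I \<subseteq> {..<n}" "J \<subseteq> {..<n}" by auto
  obtain F where F: "\<And>m :: nat. generic_array (F m) n" and lim: "\<And>i j. (\<lambda>m. F m i j) \<longlonglongrightarrow> f i j"
    using exists_generic_sequence by metis
  have "card (I - {k}) = card (J - {l})" if "k \<in> I" "l \<in> J" for k l using that fin by simp
  then have "(\<lambda>m. minor_norm (F m) I J *\<^sub>R F m i j -
      (\<Sum>l\<in>J. \<Sum>k\<in>I. F m i l * qcnj (cofactor_sum (F m) (I - {k}) (J - {l}) k l) * F m k j)) \<longlonglongrightarrow>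
    minor_norm f I J *\<^sub>R f i j -
      (\<Sum>l\<in>J. \<Sum>k\<in>I. f i l * qcnj (cofactor_sum f (I - {k}) (J - {l}) k l) * f k j)"
    using fin by (intro tendsto_intros tendsto_cofactor_sum tendsto_minor_norm lim) auto
  moreover have "(\<lambda>m. cofactor_sum (F m) I J i j) \<longlonglongrightarrow> cofactor_sum f I J i j"
    using fin by (intro tendsto_cofactor_sum lim)
  ultimately show ?thesis
    using LIMSEQ_unique generic_array.cofactor_sum_expansion_generic[OF F n fin(3)] by auto
qed

text \<open>Multiplying the adjugate identity by \<open>M\<close> on the left shows that the
  adjugate is the norm times \<open>M\<close>. Then \<open>cofactor_sum_expansion\<close> becomes
  the Schur complement.\<close>

lemma cofactor_sum_eq_schur_entry:
  assumes fin: "finite I" "finite J" "card I = card J" and inv: "inverse_on f I J M"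
  shows "cofactor_sum f I J i j = minor_norm f I J *\<^sub>R schur_entry f I J M i j"
proof -
  have "qcnj (cofactor_sum f (I - {k}) (J - {l}) k l) = minor_norm f I J *\<^sub>R M l k"
    (is "?c l k = _") if kl: "k \<in> I" "l \<in> J" for k l
  proof -
    have "?c l k = (\<Sum>y\<in>J. of_bool (l = y) * ?c y k)"
      using sum_of_bool_mult(1)[OF fin(2) kl(2), of "\<lambda>y. ?c y k"] by simp
    also have "\<dots> = (\<Sum>y\<in>J. (\<Sum>x\<in>I. M l x * f x y) * ?c y k)"
      using inv kl by (intro sum.cong) (auto simp: inverse_on_def)
    also have "\<dots> = (\<Sum>y\<in>J. \<Sum>x\<in>I. M l x * (f x y * ?c y k))"
      by (simp add: sum_distrib_right mult.assoc)
    also have "\<dots> = (\<Sum>x\<in>I. M l x * (\<Sum>y\<in>J. f x y * ?c y k))"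
      by (subst sum.swap) (simp add: sum_distrib_left)
    also have "\<dots> = (\<Sum>x\<in>I. minor_norm f I J *\<^sub>R (M l x * of_bool (x = k)))"
      using cofactor_sum_inverse[OF fin _ kl(1)] by (intro sum.cong) auto
    also have "\<dots> = minor_norm f I J *\<^sub>R M l k"
      unfolding scaleR_sum_right[symmetric] using sum_of_bool_mult(2)[OF fin(1) kl(1), of "M l"] by simp
    finally show ?thesis .
  qed
  then show ?thesis
    unfolding cofactor_sum_expansion[OF fin]
    by (simp add: schur_entry_def scaleR_diff_right scaleR_sum_right)
qed

section \<open>The norm and the quasideterminants of matrices\<close>

definition delete_nth :: "nat \<Rightarrow> 'b list \<Rightarrow> 'b list" where
  "delete_nth i xs = take i xs @ drop (Suc i) xs"

lemma length_delete_nth [simp]: "i < length xs \<Longrightarrow> length (delete_nth i xs) = length xs - 1"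
  by (simp add: delete_nth_def)

lemma nth_delete_nth:
  "i < length xs \<Longrightarrow> k < length xs - 1 \<Longrightarrow> delete_nth i xs ! k = xs ! (if k < i then k else Suc k)"
  by (auto simp: delete_nth_def nth_append)

lemma distinct_delete_nth: "distinct xs \<Longrightarrow> distinct (delete_nth i xs)"
  by (auto simp: delete_nth_def set_take_disj_set_drop_if_distinct)

lemma set_delete_nth:
  assumes "distinct xs" "i < length xs"
  shows "set (delete_nth i xs) = set xs - {xs ! i}"
proof -
  have xs: "xs = take i xs @ xs ! i # drop (Suc i) xs" using assms id_take_nth_drop by blast
  then have "distinct (take i xs @ xs ! i # drop (Suc i) xs)" using assms by metis
  moreover have "set xs = insert (xs ! i) (set (delete_nth i xs))"
    by (subst xs) (auto simp: delete_nth_def)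
  ultimately show ?thesis by (auto simp: delete_nth_def)
qed

lemma mat_delete_lmat:
  "i < length rs \<Longrightarrow> j < length cs \<Longrightarrow>
    mat_delete (lmat f rs cs) i j = lmat f (delete_nth i rs) (delete_nth j cs)"
  by (rule eq_matI) (auto simp: mat_delete_def nth_delete_nth)

lemma mat_inv_eqI:
  assumes A: "A \<in> carrier_mat n n" and B: "B \<in> carrier_mat n n" and "A * B = 1\<^sub>m n" "B * A = 1\<^sub>m n"
  shows "mat_inv A = B"
  unfolding mat_inv_def
proof (rule the_equality)
  show "inverts_mat A B \<and> inverts_mat B A" using assms by (simp add: inverts_mat_def)
next
  fix C assume "inverts_mat A C \<and> inverts_mat C A"
  then have C: "A * C = 1\<^sub>m n" "C * A = 1\<^sub>m (dim_row C)" using A by (auto simp: inverts_mat_def)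
  \<comment> \<open>\<open>inverts_mat\<close> does not prescribe the size of \<open>C\<close>; the
    two identity matrices force it.\<close>
  have "dim_col (A * C) = n" "dim_col (C * A) = dim_row C" unfolding C by simp_all
  then have car: "C \<in> carrier_mat n n" using A by auto
  then have "C = (B * A) * C" using assms by simp
  also have "\<dots> = B * (A * C)" using A B car by (simp add: assoc_mult_mat[of _ n n _ n _ n])
  also have "\<dots> = B" using B C by simp
  finally show "C = B" .
qed

lemma sum_nth_eq_sum_set: "distinct xs \<Longrightarrow> (\<Sum>k\<in>{0..<length xs}. g (xs ! k)) = sum g (set xs)"
  by (rule sum.reindex_bij_betw) (rule bij_betw_nth, auto)

text \<open>Passes from positions in the lists, which deletion renumbers, to indices that stay
  fixed.\<close>

lemma quasidet_lmat:
  fixes f :: "'i \<Rightarrow> 'j \<Rightarrow> 'a :: ring_1"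
  assumes d: "distinct rs" "distinct cs" and l: "length rs = length cs"
    and ij: "i < length rs" "j < length cs"
    and inv: "inverse_on f (set rs - {rs ! i}) (set cs - {cs ! j}) M"
  shows "quasidet (lmat f rs cs) i j =
    schur_entry f (set rs - {rs ! i}) (set cs - {cs ! j}) M (rs ! i) (cs ! j)"
proof -
  define rs' where "rs' = delete_nth i rs"
  define cs' where "cs' = delete_nth j cs"
  have rs': "distinct rs'" "length rs' = length rs - 1" "set rs' = set rs - {rs ! i}"
    and cs': "distinct cs'" "length cs' = length rs - 1" "set cs' = set cs - {cs ! j}"
    using d ij l by (simp_all add: rs'_def cs'_def distinct_delete_nth set_delete_nth)
  have "mat_inv (lmat f rs' cs') = lmat M cs' rs'"
    using inv unfolding rs'(3)[symmetric] cs'(3)[symmetric] inverse_on_iff_lmat[OF rs'(1) cs'(1)] rs'(2) cs'(2)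
    by (intro mat_inv_eqI[OF lmat_carrier' lmat_carrier']) (auto simp: rs'(2) cs'(2))
  then have m: "mat_inv (mat_delete (lmat f rs cs) i j) = lmat M cs' rs'"
    using ij by (simp add: mat_delete_lmat rs'_def cs'_def)
  have "row_delete (lmat f rs cs) i j \<bullet> (lmat M cs' rs' *\<^sub>v col_delete (lmat f rs cs) i j) =
    (\<Sum>a\<in>{0..<length cs'}. f (rs ! i) (cs' ! a) *
      (\<Sum>b\<in>{0..<length rs'}. M (cs' ! a) (rs' ! b) * f (rs' ! b) (cs ! j)))"
    using ij l rs'(2) cs'(2)
    by (auto simp: scalar_prod_def row_delete_def col_delete_def nth_delete_nth rs'_def cs'_def
        intro!: sum.cong arg_cong2[of _ _ _ _ "(*)"])
  also have "\<dots> = (\<Sum>l\<in>set cs'. \<Sum>k\<in>set rs'. f (rs ! i) l * M l k * f k (cs ! j))"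
    unfolding sum_nth_eq_sum_set[OF rs'(1), of "\<lambda>k. M _ k * f k (cs ! j)"]
      sum_nth_eq_sum_set[OF cs'(1), of "\<lambda>l. f (rs ! i) l * (\<Sum>k\<in>set rs'. M l k * f k (cs ! j))"]
    by (simp add: sum_distrib_left mult.assoc)
  finally show ?thesis
    using ij by (simp add: quasidet_def m schur_entry_def rs'(3) cs'(3))
qed

section \<open>The norm as the Study determinant\<close>

context generic_array
begin

text \<open>\<open>generic_nu\<close> always deletes row and column 0, so it runs through the
  trailing principal submatrices, and each step is a Schur complement step.\<close>

lemma generic_nu_tail:
  assumes "k \<le> n"
  shows "generic_nu (n - k) (lmat f [k..<n] [k..<n]) = minor_norm f {k..<n} {k..<n}"
  using assms
proof (induction "n - k" arbitrary: k)
  case (Suc d)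
  then have k: "k < n" "d = n - Suc k" by auto
  define rs where "rs = [Suc k..<n]"
  have up: "[k..<n] = k # rs" using k by (simp add: upt_rec rs_def)
  have set: "set rs = {Suc k..<n}" "{k..<n} = insert k {Suc k..<n}" using k by (auto simp: rs_def)
  have "inverse_on f {Suc k..<n} {Suc k..<n} (inverse_of f {Suc k..<n} {Suc k..<n})"
    by (rule inverse_of) auto
  moreover have "insert k {Suc k..<n} - {k} = {Suc k..<n}" by auto
  ultimately have q: "quasidet (lmat f (k # rs) (k # rs)) 0 0 = quasi f {Suc k..<n} {Suc k..<n} k k"
    using quasidet_lmat[of "k # rs" "k # rs" 0 0 f "inverse_of f {Suc k..<n} {Suc k..<n}"]
    by (simp add: set quasi_def) (simp add: rs_def)
  have del: "mat_delete (lmat f (k # rs) (k # rs)) 0 0 = lmat f rs rs"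
    by (simp add: mat_delete_lmat) (simp add: delete_nth_def)
  have IH: "generic_nu d (lmat f rs rs) = minor_norm f {Suc k..<n} {Suc k..<n}"
    using Suc.hyps(1)[of "Suc k"] k by (simp add: rs_def)
  have "generic_nu (Suc d) (lmat f (k # rs) (k # rs)) =
      nu (quasi f {Suc k..<n} {Suc k..<n} k k) * generic_nu d (lmat f rs rs)"
  \<comment> \<open>Order 1 has its own clause in \<open>generic_nu\<close>; there the
    quasideterminant over empty sets is the entry itself.\<close>
  proof (cases d)
    case 0
    then have "{Suc k..<n} = {}" "rs = []" using k by (auto simp: rs_def)
    then show ?thesis using 0 by (simp add: quasi_def schur_entry_def)
  next
    case (Suc d')
    then show ?thesis using q del by simp
  qed
  moreover have "minor_norm f (insert k {Suc k..<n}) (insert k {Suc k..<n}) =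
      nu (quasi f {Suc k..<n} {Suc k..<n} k k) * minor_norm f {Suc k..<n} {Suc k..<n}"
    using k by (intro minor_norm_insert) auto
  ultimately show ?case using IH Suc.hyps(2) by (simp add: set(2) up del: upt.simps)
qed simp

end

lemma mat_eq_lmat:
  assumes "A \<in> carrier_mat n m"
  shows "A = lmat (\<lambda>i j. A $$ (i, j)) [0..<n] [0..<m]"
  using assms by (intro eq_matI) auto

lemma distinct_map_pick: "distinct (map (pick I) [0..<card I])"
  unfolding distinct_map
  by (auto intro!: inj_onI) (metis card_pick_le)

lemma set_map_pick: "finite I \<Longrightarrow> set (map (pick I) [0..<card I]) = I"
  by (intro card_subset_eq)
     (auto simp: pick_in_set_le distinct_card[OF distinct_map_pick, of I, simplified])

lemma submatrix_eq_lmat: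
  assumes A: "A \<in> carrier_mat n m" and IJ: "I \<subseteq> {..<n}" "J \<subseteq> {..<m}"
  shows "submatrix A I J =
    lmat (\<lambda>i j. A $$ (i, j)) (map (pick I) [0..<card I]) (map (pick J) [0..<card J])"
proof -
  have "{i. i < n \<and> i \<in> I} = I" "{j. j < m \<and> j \<in> J} = J" using IJ by auto
  then show ?thesis using A by (intro eq_matI) (auto simp: submatrix_def)
qed

lemma study_norm_submatrix:
  assumes A: "A \<in> carrier_mat n m" and IJ: "I \<subseteq> {..<n}" "J \<subseteq> {..<m}" and card: "card I = card J"
  shows "study_norm (submatrix A I J) = minor_norm (\<lambda>i j. A $$ (i, j)) I J"
proof -
  have fin: "finite I" "finite J" using IJ by (auto intro: finite_subset)
  have "length (map (pick I) [0..<card I]) = length (map (pick J) [0..<card J])" using card by simp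
  from study_norm_lmat[OF distinct_map_pick distinct_map_pick this] show ?thesis
    unfolding submatrix_eq_lmat[OF A IJ] set_map_pick[OF fin(1)] set_map_pick[OF fin(2)] .
qed

lemma submatrix_carrier:
  assumes "A \<in> carrier_mat n m" "I \<subseteq> {..<n}" "J \<subseteq> {..<m}"
  shows "submatrix A I J \<in> carrier_mat (card I) (card J)"
  unfolding submatrix_eq_lmat[OF assms] by (rule lmat_carrier') simp_all

lemma invertible_mat_iff_study_norm:
  assumes A: "A \<in> carrier_mat n n"
  shows "invertible_mat A \<longleftrightarrow> study_norm A \<noteq> 0"
proof
  assume "invertible_mat A"
  then obtain B where "A * B = 1\<^sub>m n" "B * A = 1\<^sub>m (dim_row B)"
    using A by (auto simp: invertible_mat_def inverts_mat_def)
  moreover from this have "dim_col (A * B) = n" "dim_col (B * A) = dim_row B" by simp_all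
  then have "B \<in> carrier_mat n n" using A by auto
  ultimately show "study_norm A \<noteq> 0" using inverse_imp_study_norm_nonzero[OF A] by blast
next
  assume "study_norm A \<noteq> 0"
  then obtain V where "V \<in> carrier_mat n n" "A * V = 1\<^sub>m n" "V * A = 1\<^sub>m n"
    using study_norm_nonzero_imp_inverse[OF A] by metis
  then show "invertible_mat A" using A by (auto simp: invertible_mat_def inverts_mat_def)
qed

lemma generic_mat_iff:
  assumes A: "A \<in> carrier_mat n n"
  shows "generic_mat A \<longleftrightarrow> generic_array (\<lambda>i j. A $$ (i, j)) n"
proof -
  have "invertible_mat (submatrix A I J) \<longleftrightarrow> minor_norm (\<lambda>i j. A $$ (i, j)) I J \<noteq> 0"
    if "I \<subseteq> {..<n}" "J \<subseteq> {..<n}" "card I = card J" for I J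
    using invertible_mat_iff_study_norm[of "submatrix A I J" "card I"] submatrix_carrier[OF A that(1,2)]
      study_norm_submatrix[OF A that] that(3) by simp
  then show ?thesis using A by (auto simp: generic_mat_def generic_array_def)
qed

lemma generic_nu_eq_study_norm:
  assumes A: "A \<in> carrier_mat n n" and "generic_mat A"
  shows "generic_nu n A = study_norm A"
proof -
  interpret generic_array "\<lambda>i j. A $$ (i, j)" n using assms generic_mat_iff by blast
  have "generic_nu n A = minor_norm (\<lambda>i j. A $$ (i, j)) {0..<n} {0..<n}"
    using generic_nu_tail[of 0] mat_eq_lmat[OF A] by simp
  also have "\<dots> = study_norm A"
    using study_norm_lmat[of "[0..<n]" "[0..<n]" "\<lambda>i j. A $$ (i, j)"] mat_eq_lmat[OF A] by simp
  finally show ?thesis .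
qed

lemma minor_norm_cong:
  assumes "finite I" "finite J" "\<And>i j. i \<in> I \<Longrightarrow> j \<in> J \<Longrightarrow> f i j = g i j"
  shows "minor_norm f I J = minor_norm g I J"
  unfolding minor_norm_def using assms by (intro arg_cong[of _ _ study_norm] lmat_cong) auto

text \<open>\<open>study_norm\<close> is continuous and agrees with \<open>generic_nu\<close> on
  generic matrices, so it is the required limit.\<close>

lemma mat_nu_eq_study_norm:
  assumes A: "A \<in> carrier_mat n n"
  shows "mat_nu A = study_norm A"
proof -
  have dim: "dim_row A = n" using A by simp
  show ?thesis
    unfolding mat_nu_def dim
  proof (rule the_equality, intro allI impI)
    fix X assume X: "\<forall>m. X m \<in> carrier_mat n n \<and> generic_mat (X m)"
      and "\<forall>i<n. \<forall>j<n. (\<lambda>m. X m $$ (i, j)) \<longlonglongrightarrow> A $$ (i, j)"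
    then have "(\<lambda>m. study_norm (X m)) \<longlonglongrightarrow> study_norm A"
      using A by (intro tendsto_study_norm) auto
    then show "(\<lambda>m. generic_nu n (X m)) \<longlonglongrightarrow> study_norm A"
      using X generic_nu_eq_study_norm by simp
  next
    fix L
    assume L: "\<forall>X. (\<forall>m. X m \<in> carrier_mat n n \<and> generic_mat (X m)) \<longrightarrow>
      (\<forall>i<n. \<forall>j<n. (\<lambda>m. X m $$ (i, j)) \<longlonglongrightarrow> A $$ (i, j)) \<longrightarrow> (\<lambda>m. generic_nu n (X m)) \<longlonglongrightarrow> L"
    \<comment> \<open>Uniqueness rests on a generic sequence that converges to \<open>A\<close>;
      without one the condition on \<open>L\<close> would be vacuous.\<close>
    obtain F where F: "\<And>m :: nat. generic_array (F m) n"
      and lim: "\<And>i j. (\<lambda>m. F m i j) \<longlonglongrightarrow> A $$ (i, j)"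
      using exists_generic_sequence[of n "\<lambda>i j. A $$ (i, j)"] by metis
    define X where "X m = mat n n (\<lambda>(i, j). F m i j)" for m
    have X: "X m \<in> carrier_mat n n" for m by (simp add: X_def)
    have gen: "generic_mat (X m)" for m
      unfolding generic_mat_iff[OF X]
    proof
      fix I J assume IJ: "I \<subseteq> {..<n}" "J \<subseteq> {..<n}" "card I = card J"
      have "minor_norm (\<lambda>i j. X m $$ (i, j)) I J = minor_norm (F m) I J"
        using IJ finite_subset[OF IJ(1)] finite_subset[OF IJ(2)]
        by (intro minor_norm_cong) (auto simp: X_def subset_iff)
      then show "minor_norm (\<lambda>i j. X m $$ (i, j)) I J \<noteq> 0"
        using generic_array.minor_norm_nonzero[OF F IJ] by simp
    qed
    have limX: "(\<lambda>m. X m $$ (i, j)) \<longlonglongrightarrow> A $$ (i, j)" if "i < n" "j < n" for i j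
      using lim that by (simp add: X_def)
    then have "(\<lambda>m. study_norm (X m)) \<longlonglongrightarrow> L"
      using L X gen generic_nu_eq_study_norm[OF X gen] by (metis (no_types, lifting) ext)
    moreover have "(\<lambda>m. study_norm (X m)) \<longlonglongrightarrow> study_norm A"
      using tendsto_study_norm[OF X A limX] by simp
    ultimately show "L = study_norm A" by (rule LIMSEQ_unique)
  qed
qed

section \<open>Double permanents as parts of the cofactor sum\<close>

lemma dperm_monomial_Cons:
  "length us = length vs \<Longrightarrow>
    dperm_monomial A (i # us) (j # vs) = zigzag (\<lambda>p q. A $$ (p, q)) i j us vs"
proof (induction us arbitrary: i vs)
  case (Cons k us)
  then obtain l vs' where vs: "vs = l # vs'" "length us = length vs'" by (cases vs) auto
  let ?g = "\<lambda>ps qs t. A $$ (ps ! (t - 1), qs ! t) * qcnj (A $$ (ps ! t, qs ! t))"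
  \<comment> \<open>The product starts at \<open>t = 1\<close>, so the head of \<open>qs\<close>
    enters only the last factor. Dropping the first two factors therefore removes \<open>i\<close>
    from \<open>ps\<close> and \<open>l\<close> from \<open>qs\<close>, while \<open>j\<close> stays
    in front.\<close>
  have "map (?g (i # k # us) (j # l # vs')) [1..<Suc (Suc (length us))] =
      A $$ (i, l) * qcnj (A $$ (k, l)) # map (?g (k # us) (j # vs')) [1..<Suc (length us)]"
    by (rule nth_equalityI) (auto simp: nth_Cons simp del: upt_Suc split: nat.splits)
  then have "dperm_monomial A (i # k # us) (j # l # vs') =
      A $$ (i, l) * qcnj (A $$ (k, l)) * dperm_monomial A (k # us) (j # vs')"
    by (simp add: dperm_monomial_def mult.assoc del: upt_Suc)
  then show ?case using Cons.IH vs by simp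
qed (simp add: dperm_monomial_def)

text \<open>Paths are grouped by their supports. Those with support \<open>(I, J)\<close> correspond
  to the orderings of \<open>I\<close> and \<open>J\<close> that begin with \<open>i\<close> and
  \<open>j\<close>.\<close>

lemma sum_double_permanent:
  assumes ij: "i < n" "j < n"
  shows "(\<Sum>(I, J) \<in> {(I, J) \<in> square_submatrices n. i \<in> I \<and> j \<in> J}.
      ((-1) ^ (card I - 1) * minor_norm (\<lambda>p q. A $$ (p, q)) ({..<n} - I) ({..<n} - J)) *\<^sub>R
        double_permanent A I J i j) =
    cofactor_sum (\<lambda>p q. A $$ (p, q)) ({..<n} - {i}) ({..<n} - {j}) i j"
proof -
  let ?f = "\<lambda>p q. A $$ (p, q)" and ?I = "{..<n} - {i}" and ?J = "{..<n} - {j}"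
  let ?T = "{(I, J) \<in> square_submatrices n. i \<in> I \<and> j \<in> J}" and ?S = "index_paths ?I ?J"
  define h where "h = (\<lambda>(us, vs). ((-1) ^ length us * minor_norm ?f (?I - set us) (?J - set vs)) *\<^sub>R zigzag ?f i j us vs)"
  define supp where "supp = (\<lambda>(us, vs). (insert i (set us), insert j (set vs)))"
  have finT: "finite ?T"
    by (rule finite_subset[of _ "Pow {..<n} \<times> Pow {..<n}"]) (auto simp: square_submatrices_def)
  have "supp us_vs \<in> ?T" if "us_vs \<in> ?S" for us_vs
  proof -
    obtain us vs where uv: "us_vs = (us, vs)" by fastforce
    have p: "distinct us" "distinct vs" "set us \<subseteq> ?I" "set vs \<subseteq> ?J" "length us = length vs"
      using that by (auto simp: uv index_paths_def)
    then have "i \<notin> set us" "j \<notin> set vs" by auto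
    then have "card (insert i (set us)) = card (insert j (set vs))" using p by (simp add: distinct_card)
    then show ?thesis using p ij by (auto simp: uv supp_def square_submatrices_def)
  qed
  then have "supp ` ?S \<subseteq> ?T" by (rule image_subsetI)
  then have "sum h ?S = (\<Sum>IJ\<in>?T. \<Sum>x\<in>{x \<in> ?S. supp x = IJ}. h x)"
    using sum.group[of ?S ?T supp h] finT finite_index_paths by simp
  also have "\<dots> = (\<Sum>(I, J)\<in>?T.
      ((-1) ^ (card I - 1) * minor_norm ?f ({..<n} - I) ({..<n} - J)) *\<^sub>R double_permanent A I J i j)"
  proof (rule sum.cong[OF refl], clarify)
    fix I J assume IJ: "(I, J) \<in> square_submatrices n" "i \<in> I" "j \<in> J"
    then have sub: "I \<subseteq> {..<n}" "J \<subseteq> {..<n}" "card I = card J" "finite I" "finite J"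
      by (auto simp: square_submatrices_def intro: finite_subset)
    let ?c = "(-1) ^ (card I - 1) * minor_norm ?f ({..<n} - I) ({..<n} - J)"
    let ?P = "{ps \<in> permutations_of_set I. hd ps = i}" and ?Q = "{qs \<in> permutations_of_set J. hd qs = j}"
    have hd: "\<exists>us. ps = x # us \<and> x \<notin> set us \<and> distinct us \<and> set us = X - {x} \<and> Suc (length us) = card X"
      if ps: "ps \<in> permutations_of_set X" "hd ps = x" "x \<in> X" for ps x and X :: "nat set"
    proof -
      have p: "set ps = X" "distinct ps" using ps by (auto simp: permutations_of_set_def)
      then obtain us where "ps = x # us" using ps by (cases ps) auto
      then show ?thesis using p distinct_card[OF p(2)] by auto
    qed
    have "(\<Sum>x\<in>{x \<in> ?S. supp x = (I, J)}. h x) = (\<Sum>(ps, qs)\<in>?P \<times> ?Q. ?c *\<^sub>R dperm_monomial A ps qs)"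
    proof (rule sum.reindex_bij_witness[of _ "\<lambda>(ps, qs). (tl ps, tl qs)" "\<lambda>(us, vs). (i # us, j # vs)"])
      fix x assume x: "x \<in> {x \<in> ?S. supp x = (I, J)}"
      obtain us vs where uv: "x = (us, vs)" by fastforce
      have p: "distinct us" "distinct vs" "i \<notin> set us" "j \<notin> set vs" "length us = length vs"
        "insert i (set us) = I" "insert j (set vs) = J"
        using x by (auto simp: uv index_paths_def supp_def)
      show "(case case x of (us, vs) \<Rightarrow> (i # us, j # vs) of (ps, qs) \<Rightarrow> (tl ps, tl qs)) = x"
        by (simp add: uv)
      show "(case x of (us, vs) \<Rightarrow> (i # us, j # vs)) \<in> ?P \<times> ?Q"
        using p by (auto simp: uv permutations_of_set_def)
      \<comment> \<open>The path leaves out \<open>i\<close>, so its length is the exponent of the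
        sign.\<close>
      have "card I - 1 = length us" using p distinct_card[OF p(1)] by auto
      moreover have "?I - set us = {..<n} - I" "?J - set vs = {..<n} - J" using p by auto
      ultimately show "(case case x of (us, vs) \<Rightarrow> (i # us, j # vs) of
          (ps, qs) \<Rightarrow> ?c *\<^sub>R dperm_monomial A ps qs) = h x"
        using p(5) by (simp add: uv h_def dperm_monomial_Cons)
    next
      fix y assume "y \<in> ?P \<times> ?Q"
      then obtain ps qs where y: "y = (ps, qs)" "ps \<in> permutations_of_set I" "hd ps = i"
        "qs \<in> permutations_of_set J" "hd qs = j" by auto
      from hd[OF y(2,3) IJ(2)] obtain us where us: "ps = i # us" "distinct us" "set us = I - {i}"
        "Suc (length us) = card I" by blast
      from hd[OF y(4,5) IJ(3)] obtain vs where vs: "qs = j # vs" "distinct vs" "set vs = J - {j}"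
        "Suc (length vs) = card J" by blast
      show "(case case y of (ps, qs) \<Rightarrow> (tl ps, tl qs) of (us, vs) \<Rightarrow> (i # us, j # vs)) = y"
        by (simp add: y(1) us(1) vs(1))
      show "(case y of (ps, qs) \<Rightarrow> (tl ps, tl qs)) \<in> {x \<in> ?S. supp x = (I, J)}"
        using us vs sub IJ(2,3) by (auto simp: y(1) index_paths_def supp_def)
    qed
    also have "\<dots> = ?c *\<^sub>R double_permanent A I J i j"
      by (simp add: double_permanent_def sum.cartesian_product scaleR_sum_right case_prod_beta)
    finally show "(\<Sum>x\<in>{x \<in> ?S. supp x = (I, J)}. h x) = ?c *\<^sub>R double_permanent A I J i j" .
  qed
  finally show ?thesis by (simp add: cofactor_sum_def h_def)
qed

section \<open>The expansion of the scaled quasideterminant\<close>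

theorem theorem3p3:
  fixes A :: "quat mat" and n i j :: nat
  assumes "A \<in> carrier_mat n n" and "i < n" and "j < n"
    and "invertible_mat (mat_delete A i j)"
  shows "of_real (mat_nu (mat_delete A i j)) * quasidet A i j =
    (\<Sum>(I, J) \<in> {(I, J) \<in> square_submatrices n. i \<in> I \<and> j \<in> J}.
       (-1) ^ (card I - 1) * of_real (mat_nu (compl_submatrix A I J)) * double_permanent A I J i j)"
proof -
  let ?f = "\<lambda>p q. A $$ (p, q)" and ?I = "{..<n} - {i}" and ?J = "{..<n} - {j}"
  let ?rs = "delete_nth i [0..<n]" and ?cs = "delete_nth j [0..<n]"
  have A: "lmat ?f [0..<n] [0..<n] = A" using mat_eq_lmat[OF assms(1)] by simp
  have d: "distinct ?rs" "distinct ?cs" "length ?rs = length ?cs" "set ?rs = ?I" "set ?cs = ?J"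
    using assms(2,3) by (simp_all add: distinct_delete_nth set_delete_nth lessThan_atLeast0)
  have del: "mat_delete A i j = lmat ?f ?rs ?cs"
    using mat_delete_lmat[of i "[0..<n]" j "[0..<n]" ?f] assms(2,3) by (simp add: A)
  have car: "mat_delete A i j \<in> carrier_mat (length ?rs) (length ?rs)"
    unfolding del by (rule lmat_carrier'[OF refl d(3)[symmetric]])
  have N: "study_norm (mat_delete A i j) = minor_norm ?f ?I ?J"
    using study_norm_lmat[OF d(1-3), of ?f] by (simp only: del d(4,5))
  have fin: "finite ?I" "finite ?J" "card ?I = card ?J" using assms(2,3) by auto
  \<comment> \<open>Invertibility means that the norm is nonzero, which yields an inverse that keeps
    the original indices.\<close>
  have "minor_norm ?f ?I ?J \<noteq> 0"
    using assms(4) unfolding invertible_mat_iff_study_norm[OF car] N .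
  then obtain M where M: "inverse_on ?f ?I ?J M" using minor_norm_nonzero_imp_inverse[OF fin] by metis
  have "quasidet A i j = schur_entry ?f ?I ?J M i j"
    using quasidet_lmat[of "[0..<n]" "[0..<n]" i j ?f M] assms(2,3) M by (simp add: A lessThan_atLeast0)
  then have "of_real (mat_nu (mat_delete A i j)) * quasidet A i j = cofactor_sum ?f ?I ?J i j"
    using cofactor_sum_eq_schur_entry[OF fin M] by (simp add: mat_nu_eq_study_norm[OF car] N scaleR_conv_of_real)
  also have "\<dots> = (\<Sum>(I, J) \<in> {(I, J) \<in> square_submatrices n. i \<in> I \<and> j \<in> J}.
       (-1) ^ (card I - 1) * of_real (mat_nu (compl_submatrix A I J)) * double_permanent A I J i j)"
    unfolding sum_double_permanent[OF assms(2,3), symmetric]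
  proof (rule sum.cong[OF refl], clarify)
    fix I J assume "(I, J) \<in> square_submatrices n"
    then have IJ: "I \<subseteq> {..<n}" "J \<subseteq> {..<n}" "card I = card J" by (auto simp: square_submatrices_def)
    then have c: "card ({..<n} - I) = card ({..<n} - J)"
      by (metis card_Diff_subset finite_lessThan finite_subset)
    have "compl_submatrix A I J = submatrix A ({..<n} - I) ({..<n} - J)"
      using assms(1) by (simp add: compl_submatrix_def)
    then have "mat_nu (compl_submatrix A I J) = minor_norm ?f ({..<n} - I) ({..<n} - J)"
      using mat_nu_eq_study_norm[of "submatrix A ({..<n} - I) ({..<n} - J)" "card ({..<n} - I)"]
        submatrix_carrier[OF assms(1), of "{..<n} - I" "{..<n} - J"]
        study_norm_submatrix[OF assms(1) _ _ c] c by simp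
    then show "((-1) ^ (card I - 1) * minor_norm ?f ({..<n} - I) ({..<n} - J)) *\<^sub>R double_permanent A I J i j =
        (-1) ^ (card I - 1) * of_real (mat_nu (compl_submatrix A I J)) * double_permanent A I J i j"
      by (simp add: scaleR_conv_of_real)
  qed
  finally show ?thesis .
qed

end
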